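(* Suppose $pn\to\infty$ and $q\ln n\to\infty$ as $n\to\infty$, where $q=1-p$. Then for every $\varepsilon>0$ there exists $n_0$ such that for all $n\ge n_0$, $$u_3(n,p)\le(2+\varepsilon)\log_{\frac{1}{1-p}}(np)\quad\text{and}\quad u_3'(n,p)\le(2+\varepsilon)\log_{\frac{1}{1-p}}(np).$$
   Context: $G(n,p)$ is the Erdős–Rényi random graph on $n$ labelled vertices (vertex set $V$), each edge present independently with probability $p=p(n)$; $\mathbb{P}_{n,p}$ is the corresponding probability and $q=1-p$. A diameter graph in $\mathbb{R}^d$ is a graph $(V,E)$ with $V\subset\mathbb{R}^d$ finite and $E=\{\{\mathbf{x},\mathbf{y}\}\subseteq V: |\mathbf{x}-\mathbf{y}|=\operatorname{diam}V\}$, where $\operatorname{diam}V=\max_{\mathbf{x},\mathbf{y}\in V}|\mathbf{x}-\mathbf{y}|$ (Euclidean norm); a graph is a diameter graph in $\mathbb{R}^d$ if it is isomorphic to one. $u_d(n,p)$ is the largest positive integer $k$ such that $\mathbb{P}_{n,p}\big(\exists W\subseteq V,\ |W|=k,\ G[W]$ is a diameter graph in $\mathbb{R}^d$ and $\chi(G[W])=d+1\big)>\frac12$, where $G[W]$ is the induced subgraph; if no such $k$ exists, $u_d(n,p)=0$. $u_d'(n,p)$ is defined identically with the additional requirement that $G[W]$ be connected. *)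

theory Defs
  imports "HOL-Analysis.Analysis"
begin

text \<open>The random graph G(n,p) on vertex set {0..<n}: a graph is given by its edge set,
a set of 2-element subsets of {0..<n}.\<close>

definition all_pairs :: "nat \<Rightarrow> nat set set" where
  "all_pairs n = {e. \<exists>i j. i < j \<and> j < n \<and> e = {i, j}}"

text \<open>Probability of a graph property Q in G(n,p), each edge independently with probability p.\<close>
definition prob_gnp :: "nat \<Rightarrow> real \<Rightarrow> (nat set set \<Rightarrow> bool) \<Rightarrow> real" where
  "prob_gnp n p Q =
     (\<Sum>E\<in>Pow (all_pairs n).
        (if Q E then p ^ card E * (1 - p) ^ (card (all_pairs n) - card E) else 0))"

text \<open>The induced subgraph G[W] (edge set E, vertex subset W) is a diameter graph in the
Euclidean space 'a: it is isomorphic to the diameter graph of some finite point set.\<close>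
definition is_diameter_graph :: "'a::euclidean_space itself \<Rightarrow> nat set \<Rightarrow> nat set set \<Rightarrow> bool" where
  "is_diameter_graph _ W E \<longleftrightarrow>
     (\<exists>f :: nat \<Rightarrow> 'a. inj_on f W \<and>
        (\<forall>u\<in>W. \<forall>v\<in>W. u \<noteq> v \<longrightarrow>
           ({u, v} \<in> E \<longleftrightarrow> dist (f u) (f v) = diameter (f ` W))))"

text \<open>Chromatic number of the induced subgraph G[W].\<close>
definition chromatic_number :: "nat set \<Rightarrow> nat set set \<Rightarrow> nat" where
  "chromatic_number W E =
     (LEAST k. \<exists>c :: nat \<Rightarrow> nat. (\<forall>v\<in>W. c v < k) \<and>
        (\<forall>u\<in>W. \<forall>v\<in>W. u \<noteq> v \<and> {u, v} \<in> E \<longrightarrow> c u \<noteq> c v))"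

text \<open>The induced subgraph G[W] is connected.\<close>
definition induced_connected :: "nat set \<Rightarrow> nat set set \<Rightarrow> bool" where
  "induced_connected W E \<longleftrightarrow>
     (\<forall>u\<in>W. \<forall>v\<in>W. (u, v) \<in> {(x, y). x \<in> W \<and> y \<in> W \<and> {x, y} \<in> E}\<^sup>*)"

definition good_set :: "'a::euclidean_space itself \<Rightarrow> bool \<Rightarrow> nat \<Rightarrow> nat \<Rightarrow> nat set set \<Rightarrow> bool" where
  "good_set T conn n k E \<longleftrightarrow>
     (\<exists>W. W \<subseteq> {0..<n} \<and> card W = k \<and> is_diameter_graph T W E
          \<and> chromatic_number W E = DIM('a) + 1
          \<and> (conn \<longrightarrow> induced_connected W E))"

text \<open>u_d(n,p) (conn = False) and u_d'(n,p) (conn = True), with d = DIM('a).\<close>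
definition u_gen :: "'a::euclidean_space itself \<Rightarrow> bool \<Rightarrow> nat \<Rightarrow> real \<Rightarrow> nat" where
  "u_gen T conn n p =
     (if \<exists>k. 0 < k \<and> prob_gnp n p (good_set T conn n k) > 1/2
      then (GREATEST k. 0 < k \<and> prob_gnp n p (good_set T conn n k) > 1/2)
      else 0)"

definition u3 :: "nat \<Rightarrow> real \<Rightarrow> nat" where
  "u3 n p = u_gen TYPE(real^3) False n p"

definition u3' :: "nat \<Rightarrow> real \<Rightarrow> nat" where
  "u3' n p = u_gen TYPE(real^3) True n p"

end

theory Submission
  imports Defs "HOL-Library.Ramsey" "HOL-Real_Asymp.Real_Asymp"
begin

text \<open>
  A diameter graph in \<open>\<real>\<^sup>3\<close> on \<open>k\<close> vertices has only \<open>O(k)\<close> edges. Given this, a first moment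
  computation suffices: a fixed \<open>k\<close>-set spans at most \<open>O(k)\<close> edges with probability about
  \<open>(p k / q)\<^bsup>O(k)\<^esup> q\<^bsup>k(k-1)/2\<^esup>\<close>, and the factors \<open>p k\<close> and \<open>1/q\<close> are only polylogarithmic in \<open>n p\<close>,
  so the union bound over all \<open>k\<close>-sets is dominated by \<open>(n p q\<^bsup>k/2\<^esup>)\<^bsup>k\<^esup>\<close>.

  For the edge bound, scale the diameter to \<open>1\<close>, orient the edges by a generic linear functional, and
  project their directions centrally to a plane. The directions leaving a vertex \<open>x\<close> span a convex
  polygon, and so do those entering \<open>y\<close>. Polygons of the same kind are disjoint, and an outgoing and
  an incoming polygon meet, if at all, in the single point of the edge \<open>(x, y)\<close>, which is a vertex
  of one of them. Instead of using Euler's formula, the contacts are counted by a sweep: a contact is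
  charged to the nearest polygon endpoint to its left that lies between the two touching polygons, and
  every endpoint is charged boundedly often.
\<close>

section \<open>Touchings of noncrossing curves\<close>

lemma card_nearest_below_le:
  fixes g :: "'i \<Rightarrow> 'b::linorder"
  assumes "finite J" and multiplicity: "\<And>v. card {i\<in>J. g i = v} \<le> m"
  shows "card {i\<in>J. g i \<le> v \<and> \<not> (\<exists>j\<in>J. g i < g j \<and> g j < v)} \<le> 2 * m"
proof -
  define B where "B = {i\<in>J. g i < v}"
  have "g i = Max (g ` B)" if "i \<in> B" "\<not> (\<exists>j\<in>J. g i < g j \<and> g j < v)" for i
    using that \<open>finite J\<close> by (intro Max_eqI[symmetric]) (auto simp: B_def not_less)
  then have "{i\<in>J. g i \<le> v \<and> \<not> (\<exists>j\<in>J. g i < g j \<and> g j < v)}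
      \<subseteq> {i\<in>J. g i = v} \<union> {i\<in>J. g i = Max (g ` B)}"
    by (auto simp: B_def le_less)
  then have "card {i\<in>J. g i \<le> v \<and> \<not> (\<exists>j\<in>J. g i < g j \<and> g j < v)}
      \<le> card ({i\<in>J. g i = v} \<union> {i\<in>J. g i = Max (g ` B)})"
    using \<open>finite J\<close> by (intro card_mono) auto
  also have "\<dots> \<le> card {i\<in>J. g i = v} + card {i\<in>J. g i = Max (g ` B)}"
    by (rule card_Un_le)
  also have "\<dots> \<le> 2 * m"
    using multiplicity[of v] multiplicity[of "Max (g ` B)"] by linarith
  finally show ?thesis .
qed

locale noncrossing_curves =
  fixes I :: "'i set" and left right :: "'i \<Rightarrow> real" and height :: "'i \<Rightarrow> real \<Rightarrow> real"
  assumes finite_I: "finite I"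
    and noncrossing: "\<And>i j. i \<in> I \<Longrightarrow> j \<in> I \<Longrightarrow> i \<noteq> j \<Longrightarrow>
      (\<forall>t\<in>{left i..right i} \<inter> {left j..right j}. height i t \<le> height j t) \<or>
      (\<forall>t\<in>{left i..right i} \<inter> {left j..right j}. height j t \<le> height i t)"
    and multiplicity: "\<And>t v. card {i\<in>I. t \<in> {left i..right i} \<and> height i t = v} \<le> 2"
    and endpoints_meet: "\<And>i j t. i \<in> I \<Longrightarrow> j \<in> I \<Longrightarrow> t \<in> {left i, right i} \<Longrightarrow> t \<in> {left j, right j} \<Longrightarrow>
      height i t = height j t"
begin

definition active :: "real \<Rightarrow> 'i set"
  where "active t = {i\<in>I. t \<in> {left i..right i}}"

definition below :: "'i \<Rightarrow> 'i \<Rightarrow> bool"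
  where "below i j \<longleftrightarrow> (\<forall>t\<in>{left i..right i} \<inter> {left j..right j}. height i t \<le> height j t)"

definition endpoints :: "('i \<times> real) set"
  where "endpoints = Sigma I (\<lambda>k. {left k, right k})"

definition lower_neighbours :: "'i \<times> real \<Rightarrow> 'i set" where
  "lower_neighbours = (\<lambda>(k, s). {i\<in>active s. height i s \<le> height k s \<and>
      \<not> (\<exists>m\<in>active s. height i s < height m s \<and> height m s < height k s)})"

definition upper_neighbours :: "'i \<times> real \<Rightarrow> 'i set" where
  "upper_neighbours = (\<lambda>(k, s). {j\<in>active s. height k s \<le> height j s \<and>
      \<not> (\<exists>m\<in>active s. height m s < height j s \<and> height k s < height m s)})"

definition endpoints_between :: "'i \<Rightarrow> 'i \<Rightarrow> real \<Rightarrow> ('i \<times> real) set" where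
  "endpoints_between i j t = {(k, s)\<in>endpoints. s \<le> t \<and> i \<in> active s \<and> j \<in> active s \<and>
      height i s \<le> height k s \<and> height k s \<le> height j s}"

definition touching_pairs :: "('i \<times> 'i) set" where
  "touching_pairs = {(i, j). i \<noteq> j \<and> (\<exists>t. i \<in> active t \<and> j \<in> active t \<and> height i t = height j t)}"

lemma finite_active: "finite (active t)"
  using finite_I by (simp add: active_def)

lemma finite_endpoints: "finite endpoints"
  using finite_I by (auto simp: endpoints_def)

lemma card_endpoints_le: "card endpoints \<le> 2 * card I"
proof -
  have "card endpoints = (\<Sum>k\<in>I. card {left k, right k})"
    unfolding endpoints_def using finite_I by simp
  also have "\<dots> \<le> (\<Sum>k\<in>I. 2)"
    by (intro sum_mono) (simp add: card_insert_if)
  finally show ?thesis by simp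
qed

lemma below_linear: "i \<in> I \<Longrightarrow> j \<in> I \<Longrightarrow> i \<noteq> j \<Longrightarrow> below i j \<or> below j i"
  using noncrossing[of i j] by (simp add: below_def Int_commute)

lemma belowD: "below i j \<Longrightarrow> i \<in> active t \<Longrightarrow> j \<in> active t \<Longrightarrow> height i t \<le> height j t"
  by (simp add: below_def active_def)

lemma below_if_less:
  assumes "i \<in> active t" "j \<in> active t" "height i t < height j t"
  shows "below i j"
proof -
  have "i \<in> I" "j \<in> I" "i \<noteq> j"
    using assms by (auto simp: active_def)
  then show ?thesis
    using below_linear belowD[of j i t] assms by fastforce
qed

lemma card_active_level_le: "card {i\<in>active t. height i t = v} \<le> 2"
  using multiplicity[of t v] by (simp add: active_def conj_assoc)

lemma card_lower_neighbours_le: "card (lower_neighbours e) \<le> 4"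
proof -
  obtain k s where e_eq: "e = (k, s)" by force
  show ?thesis
    using card_nearest_below_le[OF finite_active card_active_level_le]
    by (simp add: e_eq lower_neighbours_def)
qed

lemma card_upper_neighbours_le: "card (upper_neighbours e) \<le> 4"
proof -
  obtain k s where e_eq: "e = (k, s)" by force
  have "- height i s = v \<longleftrightarrow> height i s = - v" for i v
    by auto
  then have "card {i\<in>active s. - height i s = v} \<le> 2" for v
    using card_active_level_le[of s "- v"] by simp
  from card_nearest_below_le[OF finite_active this, where v = "- height k s"]
  show ?thesis
    by (simp add: e_eq upper_neighbours_def)
qed

lemma endpoints_between_nonempty:
  assumes "i \<in> active t" "j \<in> active t" "below i j"
  shows "endpoints_between i j t \<noteq> {}"
proof (cases "left i \<le> left j")
  case True
  then have "(j, left j) \<in> endpoints_between i j t"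
    using assms belowD[of i j "left j"] by (auto simp: endpoints_between_def endpoints_def active_def)
  then show ?thesis by blast
next
  case False
  then have "(i, left i) \<in> endpoints_between i j t"
    using assms belowD[of i j "left i"] by (auto simp: endpoints_between_def endpoints_def active_def)
  then show ?thesis by blast
qed

text \<open>A curve strictly between \<open>i\<close> and \<open>j\<close> is squeezed out by the touching at \<open>t\<close>, so it ends before
  \<open>t\<close>; its right endpoint cannot be later than the last endpoint between \<open>i\<close> and \<open>j\<close>.\<close>

lemma height_eq_if_strictly_between_at_last_endpoint:
  assumes touching: "i \<in> active t" "j \<in> active t" "i \<noteq> j" "height i t = height j t"
    and between: "(k, s) \<in> endpoints_between i j t"
    and last: "\<And>k' s'. (k', s') \<in> endpoints_between i j t \<Longrightarrow> s' \<le> s"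
    and m_between: "m \<in> active s" "height i s < height m s" "height m s < height j s"
  shows "height m s = height k s"
proof -
  have endpoint: "k \<in> I" "s \<in> {left k, right k}" "s \<le> t" "i \<in> active s" "j \<in> active s"
    using between by (auto simp: endpoints_between_def endpoints_def)
  have i_below_m: "below i m" and m_below_j: "below m j"
    using below_if_less endpoint m_between by auto
  have "right m < t"
  proof (rule ccontr)
    assume "\<not> right m < t"
    then have "m \<in> active t"
      using m_between(1) endpoint(3) by (auto simp: active_def)
    then have "height m t = height i t"
      using belowD[OF i_below_m touching(1)] belowD[OF m_below_j _ touching(2)] touching(4) by force
    then have "{m, i, j} \<subseteq> {i'\<in>active t. height i' t = height i t}"
      using touching \<open>m \<in> active t\<close> by auto
    then have "card {m, i, j} \<le> card {i'\<in>active t. height i' t = height i t}"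
      by (intro card_mono) (simp_all add: finite_active)
    also have "\<dots> \<le> 2"
      by (rule card_active_level_le)
    finally have "card {m, i, j} \<le> 2" .
    moreover have "m \<noteq> i" "m \<noteq> j"
      using m_between by auto
    ultimately show False
      using touching(3) by simp
  qed
  then have "i \<in> active (right m)" "j \<in> active (right m)" "m \<in> active (right m)" "s \<le> right m"
    using touching(1,2) endpoint(4,5) m_between(1) by (auto simp: active_def)
  moreover from this have "(m, right m) \<in> endpoints_between i j t"
    using \<open>right m < t\<close> belowD[OF i_below_m] belowD[OF m_below_j]
    by (auto simp: endpoints_between_def endpoints_def active_def)
  ultimately have "right m = s"
    using last by fastforce
  then show ?thesis
    using endpoints_meet[of m k s] endpoint(1,2) m_between(1) by (auto simp: active_def)
qed

lemma touching_pair_neighbours_of_endpoint: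
  assumes touching: "i \<in> active t" "j \<in> active t" "i \<noteq> j" "height i t = height j t" and "below i j"
  shows "\<exists>e\<in>endpoints. i \<in> lower_neighbours e \<and> j \<in> upper_neighbours e"
proof -
  let ?B = "endpoints_between i j t"
  have "finite ?B"
    by (rule finite_subset[OF _ finite_endpoints]) (auto simp: endpoints_between_def)
  then have "Max (snd ` ?B) \<in> snd ` ?B"
    using endpoints_between_nonempty[OF touching(1,2) \<open>below i j\<close>] by simp
  then obtain k s where between: "(k, s) \<in> ?B" and "s = Max (snd ` ?B)"
    by force
  then have last: "s' \<le> s" if "(k', s') \<in> ?B" for k' s'
    using that \<open>finite ?B\<close> by (metis Max_ge finite_imageI image_eqI snd_conv)
  note strictly_between = height_eq_if_strictly_between_at_last_endpoint[OF touching between last]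
  have endpoint: "(k, s) \<in> endpoints" "i \<in> active s" "j \<in> active s" "height i s \<le> height k s"
    "height k s \<le> height j s"
    using between by (auto simp: endpoints_between_def)
  have "i \<in> lower_neighbours (k, s)" "j \<in> upper_neighbours (k, s)"
    using strictly_between endpoint by (fastforce simp: lower_neighbours_def upper_neighbours_def)+
  then show ?thesis
    using endpoint(1) by blast
qed

theorem card_touching_pairs_le: "card touching_pairs \<le> 64 * card I"
proof -
  define N where "N = (\<Union>e\<in>endpoints. lower_neighbours e \<times> upper_neighbours e)"
  have "finite N"
    using finite_endpoints finite_active by (auto simp: N_def lower_neighbours_def upper_neighbours_def)
  have "card N \<le> (\<Sum>e\<in>endpoints. card (lower_neighbours e \<times> upper_neighbours e))"
    unfolding N_def by (rule card_UN_le[OF finite_endpoints])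
  also have "\<dots> \<le> (\<Sum>e\<in>endpoints. 4 * 4)"
    unfolding card_cartesian_product
    by (intro sum_mono mult_le_mono card_lower_neighbours_le card_upper_neighbours_le)
  finally have "card N \<le> 32 * card I"
    using card_endpoints_le by simp
  have "touching_pairs \<subseteq> N \<union> N\<inverse>"
  proof
    fix ij assume "ij \<in> touching_pairs"
    then obtain i j t where touching: "ij = (i, j)" "i \<noteq> j" "i \<in> active t" "j \<in> active t"
      "height i t = height j t"
      by (auto simp: touching_pairs_def)
    then have "below i j \<or> below j i"
      using below_linear by (auto simp: active_def)
    then have "(i, j) \<in> N \<or> (j, i) \<in> N"
      using touching_pair_neighbours_of_endpoint[of i t j]
        touching_pair_neighbours_of_endpoint[of j t i] touching
      by (auto simp: N_def)
    then show "ij \<in> N \<union> N\<inverse>"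
      using touching by auto
  qed
  then have "card touching_pairs \<le> card (N \<union> N\<inverse>)"
    using \<open>finite N\<close> by (intro card_mono) auto
  also have "\<dots> \<le> card N + card (N\<inverse>)"
    by (rule card_Un_le)
  also have "\<dots> \<le> 64 * card I"
    using \<open>card N \<le> 32 * card I\<close> by simp
  finally show ?thesis .
qed

end

section \<open>Contacts of convex hulls in the plane\<close>

lemma sections_ordered_if_separated:
  fixes n :: "real \<times> real"
  assumes "n \<noteq> 0" and S_below: "\<forall>z\<in>S. n \<bullet> z \<le> c" and T_above: "\<forall>z\<in>T. c \<le> n \<bullet> z"
    and sections: "\<And>t. t \<in> X \<Longrightarrow> (t, f t) \<in> S \<and> (t, g t) \<in> T"
  shows "(\<forall>t\<in>X. f t \<le> g t) \<or> (\<forall>t\<in>X. g t \<le> f t)"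
proof -
  obtain a b where n_eq: "n = (a, b)" by force
  have sides: "a * t + b * f t \<le> c" "c \<le> a * t + b * g t" if "t \<in> X" for t
    using S_below T_above sections[OF that] by (auto simp: n_eq)
  then have scaled: "b * f t \<le> b * g t" if "t \<in> X" for t
    using that by fastforce
  consider "b > 0" | "b < 0" | "b = 0" by linarith
  then show ?thesis
  proof cases
    case 3
    then have "a \<noteq> 0"
      using \<open>n \<noteq> 0\<close> by (simp add: n_eq zero_prod_def)
    moreover have "a * s = a * t" if "s \<in> X" "t \<in> X" for s t
      using sides[OF that(1)] sides[OF that(2)] 3 by simp
    ultimately have "s = t" if "s \<in> X" "t \<in> X" for s t
      using that by simp
    then show ?thesis
      by (metis linear)
  qed (use scaled in \<open>simp_all add: mult_le_cancel_left\<close>)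
qed

lemma separating_hyperplane_extreme_point:
  fixes S T :: "'a::euclidean_space set"
  assumes "convex S" "convex T" "T \<noteq> {}" and meet: "S \<inter> T \<subseteq> {P}"
    and extreme: "P extreme_point_of S" and "S \<noteq> {P}"
  obtains n c where "n \<noteq> 0" "\<forall>z\<in>S. n \<bullet> z \<le> c" "\<forall>z\<in>T. c \<le> n \<bullet> z"
proof -
  have "P \<in> S" "convex (S - {P})"
    using extreme extreme_point_of_stillconvex[OF \<open>convex S\<close>] by auto
  then obtain Q where other_point: "Q \<in> S - {P}"
    using \<open>S \<noteq> {P}\<close> by auto
  obtain n c where separation: "n \<noteq> 0" "\<forall>z\<in>S - {P}. n \<bullet> z \<le> c" "\<forall>z\<in>T. c \<le> n \<bullet> z"
    using separating_hyperplane_sets[of "S - {P}" T]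
      \<open>convex (S - {P})\<close> \<open>convex T\<close> \<open>T \<noteq> {}\<close> other_point meet
    by blast
  have "open_segment P Q \<subseteq> S - {P}"
    using \<open>convex S\<close> \<open>P \<in> S\<close> other_point by (auto simp: open_segment_def convex_contains_segment)
  then have "open_segment P Q \<subseteq> {z. n \<bullet> z \<le> c}"
    using separation(2) by blast
  then have "closure (open_segment P Q) \<subseteq> {z. n \<bullet> z \<le> c}"
    by (rule closure_minimal) (rule closed_halfspace_le)
  then have "n \<bullet> P \<le> c"
    using other_point by (auto simp: closure_open_segment)
  then show ?thesis
    using that separation by blast
qed

definition disjoint_or_touching :: "'a::real_vector set \<Rightarrow> 'a set \<Rightarrow> bool" where
  "disjoint_or_touching S T \<longleftrightarrow>
     S \<inter> T = {} \<or> (\<exists>P. S \<inter> T = {P} \<and> (P extreme_point_of S \<or> P extreme_point_of T))"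

lemma disjoint_or_touching_commute: "disjoint_or_touching S T \<longleftrightarrow> disjoint_or_touching T S"
  by (auto simp: disjoint_or_touching_def Int_commute)

lemma sections_ordered_if_meet_in_extreme_point:
  fixes S T :: "(real \<times> real) set"
  assumes convex: "convex S" "convex T" and meet: "S \<inter> T = {P}" "P extreme_point_of S"
    and sections: "\<And>t. t \<in> X \<Longrightarrow> (t, f t) \<in> S \<and> (t, g t) \<in> T"
  shows "(\<forall>t\<in>X. f t \<le> g t) \<or> (\<forall>t\<in>X. g t \<le> f t)"
proof (cases "S = {P}")
  case True
  then have "t = fst P" if "t \<in> X" for t
    using sections[OF that] by auto
  then show ?thesis
    by (metis linear)
next
  case False
  then obtain n c where "n \<noteq> 0" "\<forall>z\<in>S. n \<bullet> z \<le> c" "\<forall>z\<in>T. c \<le> n \<bullet> z"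
    using separating_hyperplane_extreme_point[OF convex _ _ meet(2)] meet(1) by blast
  then show ?thesis
    using sections by (rule sections_ordered_if_separated)
qed

lemma sections_ordered_if_disjoint_or_touching:
  fixes S T :: "(real \<times> real) set"
  assumes convex: "convex S" "convex T" and "disjoint_or_touching S T"
    and sections: "\<And>t. t \<in> X \<Longrightarrow> (t, f t) \<in> S \<and> (t, g t) \<in> T"
  shows "(\<forall>t\<in>X. f t \<le> g t) \<or> (\<forall>t\<in>X. g t \<le> f t)"
proof -
  consider "X = {}" | "X \<noteq> {}" "S \<inter> T = {}" | P where "S \<inter> T = {P}" "P extreme_point_of S"
    | P where "T \<inter> S = {P}" "P extreme_point_of T"
    using \<open>disjoint_or_touching S T\<close> unfolding disjoint_or_touching_def by blast
  then show ?thesis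
  proof cases
    case 2
    then have "S \<noteq> {}" "T \<noteq> {}"
      using sections by blast+
    then obtain n c where "n \<noteq> 0" "\<forall>z\<in>S. n \<bullet> z \<le> c" "\<forall>z\<in>T. c \<le> n \<bullet> z"
      using separating_hyperplane_sets[OF convex] 2(2) by blast
    then show ?thesis
      using sections by (rule sections_ordered_if_separated)
  next
    case 3
    with convex show ?thesis
      using sections by (rule sections_ordered_if_meet_in_extreme_point)
  next
    case 4
    with convex(2,1) have "(\<forall>t\<in>X. g t \<le> f t) \<or> (\<forall>t\<in>X. f t \<le> g t)"
      by (rule sections_ordered_if_meet_in_extreme_point) (use sections in auto)
    then show ?thesis
      by blast
  qed simp
qed

locale touching_hulls =
  fixes I :: "'i set" and C :: "'i \<Rightarrow> (real \<times> real) set"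
  assumes finite_I: "finite I"
    and finite_C: "\<And>i. i \<in> I \<Longrightarrow> finite (C i)"
    and C_nonempty: "\<And>i. i \<in> I \<Longrightarrow> C i \<noteq> {}"
    and distinct_abscissae: "inj_on fst (\<Union>i\<in>I. C i)"
    and touching: "\<And>i j. i \<in> I \<Longrightarrow> j \<in> I \<Longrightarrow> i \<noteq> j \<Longrightarrow>
      disjoint_or_touching (convex hull C i) (convex hull C j)"
    and at_most_two: "\<And>P. card {i\<in>I. P \<in> convex hull C i} \<le> 2"
begin

definition left :: "'i \<Rightarrow> real" where "left i = Min (fst ` C i)"

definition right :: "'i \<Rightarrow> real" where "right i = Max (fst ` C i)"

text \<open>Running through the points of \<open>C i\<close> makes the sections of hulls in contact meet.\<close>

definition height :: "'i \<Rightarrow> real \<Rightarrow> real" where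
  "height i t = (SOME b. (t, b) \<in> convex hull C i \<and> (t \<in> fst ` C i \<longrightarrow> (t, b) \<in> C i))"

definition contacts :: "('i \<times> 'i) set" where
  "contacts = {(i, j) \<in> I \<times> I. i \<noteq> j \<and> C i \<inter> C j \<noteq> {}}"

lemma endpoint_in_abscissae: "i \<in> I \<Longrightarrow> t \<in> {left i, right i} \<Longrightarrow> t \<in> fst ` C i"
  using finite_C C_nonempty by (auto simp: left_def right_def)

lemma abscissa_in_range: "i \<in> I \<Longrightarrow> P \<in> C i \<Longrightarrow> fst P \<in> {left i..right i}"
  using finite_C by (simp add: left_def right_def)

lemma range_subset_abscissae_hull:
  assumes "i \<in> I"
  shows "{left i..right i} \<subseteq> fst ` (convex hull C i)"
proof (cases "left i \<le> right i")
  case True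
  have "fst ` C i \<subseteq> fst ` (convex hull C i)"
    by (intro image_mono hull_subset)
  then have "left i \<in> fst ` (convex hull C i)" "right i \<in> fst ` (convex hull C i)"
    using endpoint_in_abscissae[OF assms] by auto
  then have "closed_segment (left i) (right i) \<subseteq> fst ` (convex hull C i)"
    by (intro closed_segment_subset convex_linear_image[OF linear_fst]) auto
  then show ?thesis
    using True by (simp add: closed_segment_eq_real_ivl)
qed simp

lemma height_in_hull:
  assumes "i \<in> I" "t \<in> {left i..right i}"
  shows "(t, height i t) \<in> convex hull C i" "t \<in> fst ` C i \<Longrightarrow> (t, height i t) \<in> C i"
proof -
  obtain b where "(t, b) \<in> convex hull C i"
    using range_subset_abscissae_hull assms by force
  moreover have "\<exists>b. (t, b) \<in> C i \<and> (t, b) \<in> convex hull C i" if "t \<in> fst ` C i"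
    using that hull_subset[of "C i" convex] by force
  ultimately have "\<exists>b. (t, b) \<in> convex hull C i \<and> (t \<in> fst ` C i \<longrightarrow> (t, b) \<in> C i)"
    by metis
  from someI_ex[OF this]
  show "(t, height i t) \<in> convex hull C i" "t \<in> fst ` C i \<Longrightarrow> (t, height i t) \<in> C i"
    by (auto simp: height_def)
qed

lemma height_eq_snd:
  assumes "i \<in> I" "P \<in> C j" "j \<in> I" "fst P \<in> fst ` C i"
  shows "height i (fst P) = snd P"
proof -
  have "fst P \<in> {left i..right i}"
    using assms(1,4) abscissa_in_range by auto
  then have "(fst P, height i (fst P)) \<in> C i"
    by (intro height_in_hull(2) assms)
  then have "(fst P, height i (fst P)) = P"
    using assms(1-3) by (intro inj_onD[OF distinct_abscissae]) auto
  then show ?thesis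
    by (metis snd_conv)
qed

sublocale noncrossing_curves I left right height
proof
  fix i j assume ij: "i \<in> I" "j \<in> I" "i \<noteq> j"
  show "(\<forall>t\<in>{left i..right i} \<inter> {left j..right j}. height i t \<le> height j t) \<or>
      (\<forall>t\<in>{left i..right i} \<inter> {left j..right j}. height j t \<le> height i t)"
    by (rule sections_ordered_if_disjoint_or_touching[OF _ _ touching[OF ij]])
      (use ij height_in_hull(1) in auto)
next
  fix t v
  have "card {i\<in>I. t \<in> {left i..right i} \<and> height i t = v} \<le> card {i\<in>I. (t, v) \<in> convex hull C i}"
    using finite_I height_in_hull(1) by (intro card_mono) auto
  then show "card {i\<in>I. t \<in> {left i..right i} \<and> height i t = v} \<le> 2"
    using at_most_two order_trans by blast
next
  fix i j t assume ij: "i \<in> I" "j \<in> I" "t \<in> {left i, right i}" "t \<in> {left j, right j}"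
  then obtain P where "P \<in> C j" "t = fst P"
    using endpoint_in_abscissae by blast
  then show "height i t = height j t"
    using height_eq_snd[of i P j] height_eq_snd[of j P j] endpoint_in_abscissae[of i t] ij by auto
qed (rule finite_I)

lemma contacts_subset_touching_pairs: "contacts \<subseteq> touching_pairs"
proof
  fix ij assume "ij \<in> contacts"
  then obtain i j P where sides: "ij = (i, j)" "i \<in> I" "j \<in> I" "i \<noteq> j"
    and common_point: "P \<in> C i" "P \<in> C j"
    by (auto simp: contacts_def)
  have "height i (fst P) = height j (fst P)"
    using height_eq_snd[of i P i] height_eq_snd[of j P j] sides common_point by simp
  moreover have "i \<in> active (fst P)" "j \<in> active (fst P)"
    using sides common_point abscissa_in_range unfolding active_def by blast+
  ultimately show "ij \<in> touching_pairs"
    using sides unfolding touching_pairs_def by blast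
qed

lemma finite_contacts: "finite contacts"
  by (rule finite_subset[of _ "I \<times> I"]) (auto simp: contacts_def finite_I)

theorem card_contacts_le: "card contacts \<le> 64 * card I"
proof -
  have "touching_pairs \<subseteq> I \<times> I"
    by (auto simp: touching_pairs_def active_def)
  then have "card contacts \<le> card touching_pairs"
    using finite_I contacts_subset_touching_pairs by (meson card_mono finite_SigmaI finite_subset)
  also note card_touching_pairs_le
  finally show ?thesis .
qed

end

section \<open>Cones of diameter directions\<close>

lemma convex_cone_hull_finiteE:
  assumes "finite S" "z \<in> convex_cone hull S"
  obtains a where "\<And>v. v \<in> S \<Longrightarrow> 0 \<le> a v" "z = (\<Sum>v\<in>S. a v *\<^sub>R v)"
proof -
  consider "z = 0" | c x where "0 \<le> c" "x \<in> convex hull S" "z = c *\<^sub>R x"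
    using assms(2) by (auto simp: convex_cone_hull_convex_hull)
  then show ?thesis
  proof cases
    case 1
    then show ?thesis
      using that[of "\<lambda>_. 0"] by simp
  next
    case 2
    then obtain u where "\<forall>v\<in>S. 0 \<le> u v" "x = (\<Sum>v\<in>S. u v *\<^sub>R v)"
      by (auto simp: convex_hull_finite[OF \<open>finite S\<close>])
    then show ?thesis
      using 2 that[of "\<lambda>v. c * u v"] by (simp add: scaleR_sum_right)
  qed
qed

lemma inner_pos_convex_cone_hull:
  fixes D :: "'a::real_inner"
  assumes pos: "\<And>v. v \<in> S \<Longrightarrow> 0 < v \<bullet> D" and in_cone: "z \<in> convex_cone hull S" "z \<noteq> 0"
  shows "0 < z \<bullet> D"
proof -
  obtain c x where z_scaled: "0 \<le> c" "x \<in> convex hull S" "z = c *\<^sub>R x"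
    using in_cone by (auto simp: convex_cone_hull_convex_hull)
  have "convex hull S \<subseteq> {x. D \<bullet> x > 0}"
    using pos by (intro hull_minimal convex_halfspace_gt) (auto simp: inner_commute)
  then show ?thesis
    using z_scaled in_cone(2) by (auto simp: inner_commute)
qed

lemma inner_pos_if_norm_diff_le_one:
  fixes v D :: "'a::real_inner"
  assumes "norm v = 1" "norm (v - D) \<le> 1" "D \<noteq> 0"
  shows "0 < v \<bullet> D"
proof -
  have "(norm (v - D))\<^sup>2 \<le> 1"
    using assms(2) by (simp add: power_le_one)
  then have "(norm D)\<^sup>2 \<le> 2 * (v \<bullet> D)"
    using assms(1) by (simp add: power2_norm_eq_inner norm_eq_1 algebra_simps inner_commute)
  moreover have "0 < (norm D)\<^sup>2"
    using assms(3) by simp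
  ultimately show ?thesis
    by linarith
qed

lemma unit_cones_disjoint:
  fixes D :: "'a::real_inner"
  assumes "\<And>v. v \<in> S \<Longrightarrow> norm v = 1 \<and> norm (v - D) \<le> 1"
    and "\<And>v. v \<in> T \<Longrightarrow> norm v = 1 \<and> norm (v + D) \<le> 1"
    and "D \<noteq> 0" and "z \<in> convex_cone hull S" "z \<in> convex_cone hull T"
  shows "z = 0"
proof (rule ccontr)
  assume "z \<noteq> 0"
  have "0 < v \<bullet> D" if "v \<in> S" for v
    using assms(1)[OF that] \<open>D \<noteq> 0\<close> by (intro inner_pos_if_norm_diff_le_one) auto
  then have "0 < z \<bullet> D"
    using assms(4) \<open>z \<noteq> 0\<close> by (rule inner_pos_convex_cone_hull)
  moreover have "0 < v \<bullet> - D" if "v \<in> T" for v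
    using assms(2)[OF that] \<open>D \<noteq> 0\<close> by (intro inner_pos_if_norm_diff_le_one) auto
  then have "0 < z \<bullet> - D"
    using assms(5) \<open>z \<noteq> 0\<close> by (rule inner_pos_convex_cone_hull)
  ultimately show False
    by simp
qed

lemma norm_conic_combination_le:
  fixes S :: "'a::real_normed_vector set"
  assumes "\<And>v. v \<in> S \<Longrightarrow> norm v = 1" "\<And>v. v \<in> S \<Longrightarrow> 0 \<le> a v"
  shows "norm (\<Sum>v\<in>S. a v *\<^sub>R v) \<le> sum a S"
proof -
  have "norm (\<Sum>v\<in>S. a v *\<^sub>R v) \<le> (\<Sum>v\<in>S. norm (a v *\<^sub>R v))"
    by (rule norm_sum)
  also have "\<dots> = sum a S"
    using assms by (intro sum.cong) auto
  finally show ?thesis .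
qed

lemma unit_conic_combination_tight:
  fixes d :: "'a::real_inner"
  assumes "finite S" and unit: "\<And>v. v \<in> S \<Longrightarrow> norm v = 1" and nonneg: "\<And>v. v \<in> S \<Longrightarrow> 0 \<le> a v"
    and "norm d = 1" and tight: "d \<bullet> (\<Sum>v\<in>S. a v *\<^sub>R v) = sum a S" and "sum a S \<noteq> 0"
  shows "d \<in> S"
proof -
  have inner_le_1: "d \<bullet> v \<le> 1" if "v \<in> S" for v
    using norm_cauchy_schwarz[of d v] unit[OF that] \<open>norm d = 1\<close> by simp
  have "(\<Sum>v\<in>S. a v * (1 - d \<bullet> v)) = 0"
    using tight by (simp add: inner_sum_right right_diff_distrib sum_subtractf)
  then have zero: "a v * (1 - d \<bullet> v) = 0" if "v \<in> S" for v
    using sum_nonneg_eq_0_iff[OF \<open>finite S\<close>, of "\<lambda>v. a v * (1 - d \<bullet> v)"] nonneg inner_le_1 that by simp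
  obtain v where positive_weight: "v \<in> S" "a v \<noteq> 0"
    using \<open>sum a S \<noteq> 0\<close> by (metis sum.neutral)
  then have "d \<bullet> v = norm d * norm v"
    using zero[OF positive_weight(1)] unit[OF positive_weight(1)] \<open>norm d = 1\<close> by simp
  then have "d = v"
    using norm_cauchy_schwarz_eq[of d v] unit[OF positive_weight(1)] \<open>norm d = 1\<close> by simp
  then show ?thesis
    using positive_weight(1) by simp
qed

lemma unit_conic_combinations_inner_bound:
  fixes d s :: "'a::real_inner"
  assumes unit_S: "\<And>v. v \<in> S \<Longrightarrow> norm v = 1" and unit_T: "\<And>w. w \<in> T \<Longrightarrow> norm w = 1"
    and norm_le_1: "\<And>v w. v \<in> S \<Longrightarrow> w \<in> T \<Longrightarrow> norm (v + w - d) \<le> 1"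
    and nonneg_a: "\<And>v. v \<in> S \<Longrightarrow> 0 \<le> a v" and nonneg_b: "\<And>w. w \<in> T \<Longrightarrow> 0 \<le> b w"
    and combination: "s = (\<Sum>v\<in>S. a v *\<^sub>R v)" "s = (\<Sum>w\<in>T. b w *\<^sub>R w)"
  shows "sum a S * sum b T * (1 + (norm d)\<^sup>2) + 2 * (norm s)\<^sup>2 \<le> 2 * (sum a S + sum b T) * (d \<bullet> s)"
proof -
  have "1 + (norm d)\<^sup>2 + 2 * (v \<bullet> w) - 2 * (d \<bullet> v) - 2 * (d \<bullet> w) \<le> 0" if "v \<in> S" "w \<in> T" for v w
  proof -
    have "(norm (v + w - d))\<^sup>2 \<le> 1"
      using norm_le_1[OF that] by (simp add: power_le_one)
    then show ?thesis
      using unit_S[OF that(1)] unit_T[OF that(2)]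
      by (simp add: power2_norm_eq_inner norm_eq_1 inner_commute algebra_simps)
  qed
  then have "(\<Sum>v\<in>S. \<Sum>w\<in>T. a v * b w * (1 + (norm d)\<^sup>2 + 2 * (v \<bullet> w) - 2 * (d \<bullet> v) - 2 * (d \<bullet> w))) \<le> 0"
    by (intro sum_nonpos mult_nonneg_nonpos mult_nonneg_nonneg nonneg_a nonneg_b)
  also have "(\<Sum>v\<in>S. \<Sum>w\<in>T. a v * b w * (1 + (norm d)\<^sup>2 + 2 * (v \<bullet> w) - 2 * (d \<bullet> v) - 2 * (d \<bullet> w)))
     = sum a S * sum b T * (1 + (norm d)\<^sup>2) + 2 * ((\<Sum>v\<in>S. a v *\<^sub>R v) \<bullet> (\<Sum>w\<in>T. b w *\<^sub>R w))
       - 2 * sum b T * (d \<bullet> (\<Sum>v\<in>S. a v *\<^sub>R v)) - 2 * sum a S * (d \<bullet> (\<Sum>w\<in>T. b w *\<^sub>R w))"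
    by (simp add: sum_product inner_sum_left inner_sum_right sum_distrib_left sum_distrib_right
        sum.distrib sum_subtractf sum.swap[of _ T S] algebra_simps)
  finally show ?thesis
    unfolding combination[symmetric] by (simp add: power2_norm_eq_inner algebra_simps)
qed

lemma contact_inequality_tight:
  fixes A B \<delta> \<sigma> \<tau> :: real
  assumes "0 < \<sigma>" "\<sigma> \<le> A" "\<sigma> \<le> B" "0 \<le> \<delta>" "\<delta> \<le> 1" "\<tau> \<le> \<delta> * \<sigma>"
    and "A * B * (1 + \<delta>\<^sup>2) + 2 * \<sigma>\<^sup>2 \<le> 2 * (A + B) * \<tau>"
  shows "\<delta> = 1" "\<tau> = \<sigma>" "A = \<sigma> \<or> B = \<sigma>"
proof -
  have "A * B * (1 - \<delta>)\<^sup>2 + 2 * \<sigma>\<^sup>2 * (1 - \<delta>) + 2 * \<delta> * ((A - \<sigma>) * (B - \<sigma>))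
      + 2 * ((A + B) * (\<delta> * \<sigma> - \<tau>)) \<le> 0"
    using assms(7) by (simp add: algebra_simps power2_eq_square)
  moreover have "0 \<le> A * B * (1 - \<delta>)\<^sup>2" "0 \<le> 2 * \<sigma>\<^sup>2 * (1 - \<delta>)"
    "0 \<le> 2 * \<delta> * ((A - \<sigma>) * (B - \<sigma>))" "0 \<le> 2 * ((A + B) * (\<delta> * \<sigma> - \<tau>))"
    using assms(1-6) by auto
  ultimately have zero: "2 * \<sigma>\<^sup>2 * (1 - \<delta>) = 0" "2 * \<delta> * ((A - \<sigma>) * (B - \<sigma>)) = 0"
    "2 * ((A + B) * (\<delta> * \<sigma> - \<tau>)) = 0"
    by linarith+
  then show "\<delta> = 1"
    using assms(1) by simp
  then show "\<tau> = \<sigma>" "A = \<sigma> \<or> B = \<sigma>"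
    using zero(2,3) assms(1-3) by auto
qed

text \<open>With \<open>d = y - x\<close>, \<open>S\<close> the directions of diameters leaving \<open>x\<close> and \<open>T\<close> those of diameters
  entering \<open>y\<close>, the vectors \<open>v + w - d\<close> are differences of points of the set.\<close>

lemma unit_cones_contact:
  fixes d s :: "'a::real_inner"
  assumes finite: "finite S" "finite T"
    and unit_S: "\<And>v. v \<in> S \<Longrightarrow> norm v = 1" and unit_T: "\<And>w. w \<in> T \<Longrightarrow> norm w = 1"
    and norm_d: "norm d \<le> 1" and norm_le_1: "\<And>v w. v \<in> S \<Longrightarrow> w \<in> T \<Longrightarrow> norm (v + w - d) \<le> 1"
    and common: "s \<in> convex_cone hull S" "s \<in> convex_cone hull T" "s \<noteq> 0"
  shows "norm d = 1" "s = norm s *\<^sub>R d" "d \<in> S \<or> d \<in> T"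
proof -
  obtain a where nonneg_a: "\<And>v. v \<in> S \<Longrightarrow> 0 \<le> a v" and combination_S: "s = (\<Sum>v\<in>S. a v *\<^sub>R v)"
    using convex_cone_hull_finiteE[OF finite(1) common(1)] by blast
  obtain b where nonneg_b: "\<And>w. w \<in> T \<Longrightarrow> 0 \<le> b w" and combination_T: "s = (\<Sum>w\<in>T. b w *\<^sub>R w)"
    using convex_cone_hull_finiteE[OF finite(2) common(2)] by blast
  have "norm s \<le> sum a S" "norm s \<le> sum b T"
    using norm_conic_combination_le[of S a] norm_conic_combination_le[of T b]
      unit_S unit_T nonneg_a nonneg_b
    by (simp_all add: combination_S[symmetric] combination_T[symmetric])
  moreover have "sum a S * sum b T * (1 + (norm d)\<^sup>2) + 2 * (norm s)\<^sup>2
      \<le> 2 * (sum a S + sum b T) * (d \<bullet> s)"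
    by (rule unit_conic_combinations_inner_bound[OF unit_S unit_T norm_le_1 nonneg_a nonneg_b
        combination_S combination_T])
  ultimately have tight: "norm d = 1" "d \<bullet> s = norm s" "sum a S = norm s \<or> sum b T = norm s"
    using contact_inequality_tight[of "norm s" "sum a S" "sum b T" "norm d" "d \<bullet> s"]
      common(3) norm_d norm_cauchy_schwarz[of d s] by simp_all
  show "norm d = 1"
    by (rule tight(1))
  show "s = norm s *\<^sub>R d"
    using norm_cauchy_schwarz_eq[of d s] tight(1,2) by simp
  show "d \<in> S \<or> d \<in> T"
    using unit_conic_combination_tight[of S a d] unit_conic_combination_tight[of T b d]
      finite unit_S unit_T nonneg_a nonneg_b tight common(3)
    by (auto simp: combination_S[symmetric] combination_T[symmetric])
qed

lemma convex_hull_central_projectionE: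
  fixes e :: "'a::real_inner" and L :: "'a \<Rightarrow> 'b::real_vector"
  assumes "linear L" and pos: "\<And>v. v \<in> S \<Longrightarrow> 0 < v \<bullet> e"
    and in_hull: "q \<in> convex hull ((\<lambda>v. L v /\<^sub>R (v \<bullet> e)) ` S)"
  obtains z where "z \<in> convex_cone hull S" "z \<bullet> e = 1" "L z = q"
proof -
  let ?normalize = "\<lambda>v. v /\<^sub>R (v \<bullet> e)"
  have "(\<lambda>v. L v /\<^sub>R (v \<bullet> e)) ` S = L ` ?normalize ` S"
    by (simp add: image_image linear_scale[OF \<open>linear L\<close>])
  then have "q \<in> L ` (convex hull (?normalize ` S))"
    using in_hull convex_hull_linear_image[OF \<open>linear L\<close>] by metis
  moreover have "convex hull (?normalize ` S) \<subseteq> convex_cone hull S \<inter> {z. e \<bullet> z = 1}"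
  proof (rule hull_minimal)
    show "?normalize ` S \<subseteq> convex_cone hull S \<inter> {z. e \<bullet> z = 1}"
    proof safe
      fix v assume "v \<in> S"
      then show "?normalize v \<in> convex_cone hull S"
        using pos by (intro convex_cone_hull_mul hull_inc) (auto simp: less_imp_le)
      show "e \<bullet> ?normalize v = 1"
        using pos[OF \<open>v \<in> S\<close>] by (simp add: inner_commute)
    qed
  qed (intro convex_Int convex_convex_cone_hull convex_hyperplane)
  ultimately show ?thesis
    using that by (auto simp: inner_commute)
qed

locale oriented_unit_diameters =
  fixes V :: "'a::euclidean_space set" and e :: 'a
  assumes finite_V: "finite V"
    and diameter_le_1: "\<And>x y. x \<in> V \<Longrightarrow> y \<in> V \<Longrightarrow> norm (y - x) \<le> 1"
begin

definition diameters :: "('a \<times> 'a) set"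
  where "diameters = {(x, y) \<in> V \<times> V. norm (y - x) = 1 \<and> 0 < (y - x) \<bullet> e}"

definition out_directions :: "'a \<Rightarrow> 'a set"
  where "out_directions x = {y - x |y. (x, y) \<in> diameters}"

definition in_directions :: "'a \<Rightarrow> 'a set"
  where "in_directions y = {y - x |x. (x, y) \<in> diameters}"

definition directions :: "'a set"
  where "directions = {y - x |x y. (x, y) \<in> diameters}"

lemma finite_diameters: "finite diameters"
  by (rule finite_subset[of _ "V \<times> V"]) (auto simp: diameters_def finite_V)

lemma finite_directions: "finite directions"
proof -
  have "directions = (\<lambda>(x, y). y - x) ` diameters"
    by (auto simp: directions_def)
  then show ?thesis
    using finite_diameters by simp
qed

lemma out_directions_subset: "out_directions x \<subseteq> directions"
  and in_directions_subset: "in_directions y \<subseteq> directions"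
  by (auto simp: out_directions_def in_directions_def directions_def)

lemma inner_direction_pos: "v \<in> directions \<Longrightarrow> 0 < v \<bullet> e"
  by (auto simp: directions_def diameters_def)

lemma out_directionD: "v \<in> out_directions x \<Longrightarrow> x \<in> V \<and> x + v \<in> V \<and> norm v = 1"
  and in_directionD: "v \<in> in_directions y \<Longrightarrow> y \<in> V \<and> y - v \<in> V \<and> norm v = 1"
  by (auto simp: out_directions_def in_directions_def diameters_def)

lemma out_cones_disjoint:
  assumes "x \<noteq> x'" "z \<in> convex_cone hull out_directions x" "z \<in> convex_cone hull out_directions x'"
  shows "z = 0"
proof (cases "out_directions x = {} \<or> out_directions x' = {}")
  case False
  then have "x \<in> V" "x' \<in> V"
    using out_directionD by auto
  then show ?thesis
    using assms diameter_le_1[of x'] diameter_le_1[of x] out_directionD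
    by (intro unit_cones_disjoint[of "out_directions x" "x' - x" "out_directions x'"])
      (fastforce simp: algebra_simps)+
qed (use assms in auto)

lemma in_cones_disjoint:
  assumes "y \<noteq> y'" "z \<in> convex_cone hull in_directions y" "z \<in> convex_cone hull in_directions y'"
  shows "z = 0"
proof (cases "in_directions y = {} \<or> in_directions y' = {}")
  case False
  then have "y \<in> V" "y' \<in> V"
    using in_directionD by auto
  then show ?thesis
    using assms diameter_le_1[of _ y'] diameter_le_1[of _ y] in_directionD
    by (intro unit_cones_disjoint[of "in_directions y" "y - y'" "in_directions y'"])
      (fastforce simp: algebra_simps)+
qed (use assms in auto)

lemma out_in_cones_contact:
  assumes subsets: "S \<subseteq> out_directions x" "T \<subseteq> in_directions y"
    and common: "z \<in> convex_cone hull S" "z \<in> convex_cone hull T" "z \<noteq> 0" "0 < z \<bullet> e"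
  shows "(x, y) \<in> diameters" "z = norm z *\<^sub>R (y - x)" "y - x \<in> S \<or> y - x \<in> T"
proof -
  have "finite S" "finite T"
    using subsets out_directions_subset in_directions_subset finite_directions by (meson finite_subset)+
  have "S \<noteq> {}" "T \<noteq> {}"
    using common by auto
  then have endpoints_in_V: "x \<in> V" "y \<in> V"
    using subsets out_directionD in_directionD by blast+
  have out_S: "norm v = 1" "x + v \<in> V" if "v \<in> S" for v
    using that subsets out_directionD by auto
  have in_T: "norm w = 1" "y - w \<in> V" if "w \<in> T" for w
    using that subsets in_directionD by auto
  have "norm (v + w - (y - x)) \<le> 1" if "v \<in> S" "w \<in> T" for v w
    using diameter_le_1[OF in_T(2)[OF that(2)] out_S(2)[OF that(1)]] by (simp add: algebra_simps)
  note contact = unit_cones_contact[OF \<open>finite S\<close> \<open>finite T\<close> out_S(1) in_T(1)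
    diameter_le_1[OF endpoints_in_V] this common(1-3)]
  show "z = norm z *\<^sub>R (y - x)" "y - x \<in> S \<or> y - x \<in> T"
    using contact by auto
  then have "0 < norm z * ((y - x) \<bullet> e)"
    using common(4) by (metis inner_scaleR_left)
  then have "0 < (y - x) \<bullet> e"
    using common(3) by (simp add: zero_less_mult_iff)
  then show "(x, y) \<in> diameters"
    using contact(1) endpoints_in_V by (simp add: diameters_def)
qed

end

section \<open>The number of diameters in space\<close>

lemma exists_inj_on_inner:
  fixes Z :: "'a::euclidean_space set"
  assumes "finite Z"
  obtains e where "inj_on (\<lambda>z. z \<bullet> e) Z"
proof -
  define W where "W = (\<lambda>(x, y). x - y) ` {(x, y) \<in> Z \<times> Z. x \<noteq> y}"
  have "finite W"
    using finite_subset[of "{(x, y) \<in> Z \<times> Z. x \<noteq> y}" "Z \<times> Z"] assms by (auto simp: W_def)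
  moreover have "0 \<notin> W"
    by (auto simp: W_def)
  ultimately have "negligible (\<Union>w\<in>W. {x. w \<bullet> x = 0})"
    by (intro negligible_Union) (auto intro!: negligible_hyperplane)
  then have "(\<Union>w\<in>W. {x. w \<bullet> x = 0}) \<noteq> UNIV"
    using non_negligible_UNIV by metis
  then obtain e where "\<forall>w\<in>W. w \<bullet> e \<noteq> 0"
    by auto
  then have "inj_on (\<lambda>z. z \<bullet> e) Z"
    by (fastforce simp: inj_on_def W_def inner_diff_left)
  then show ?thesis
    by (rule that)
qed

lemma exists_inj_on_inner_cross3_nonzero:
  fixes Z :: "(real^3) set" and e :: "real^3"
  assumes "finite Z" "e \<noteq> 0"
  obtains f where "inj_on (\<lambda>z. z \<bullet> f) Z" "cross3 e f \<noteq> 0"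
proof -
  obtain w where orthogonal: "w \<noteq> 0" "w \<bullet> e = 0"
    using cross_basis_nonzero[OF \<open>e \<noteq> 0\<close>] dot_cross_self by (metis inner_commute)
  obtain f where inj_f: "inj_on (\<lambda>z. z \<bullet> f) (insert 0 (insert w Z))"
    using exists_inj_on_inner assms(1) by (metis finite_insert)
  then have "w \<bullet> f \<noteq> 0"
    using orthogonal(1) by (auto dest: inj_onD[of _ _ 0 w])
  then have "cross3 w (cross3 e f) \<noteq> 0"
    using orthogonal(2) \<open>e \<noteq> 0\<close> by (simp add: Lagrange)
  then have "cross3 e f \<noteq> 0"
    by auto
  moreover have "inj_on (\<lambda>z. z \<bullet> f) Z"
    using inj_f by (rule inj_on_subset) auto
  ultimately show ?thesis
    using that by blast
qed

lemma eq_0_if_orthogonal_cross3: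
  fixes u e f :: "real^3"
  assumes "u \<bullet> e = 0" "u \<bullet> f = 0" "u \<bullet> cross3 e f = 0" "cross3 e f \<noteq> 0"
  shows "u = 0"
proof -
  have "cross3 u (cross3 e f) = 0"
    using assms(1,2) by (simp add: Lagrange)
  then show ?thesis
    using assms(3,4) norm_and_cross_eq_0 by blast
qed

locale projected_unit_diameters = oriented_unit_diameters V e for V :: "(real^3) set" and e +
  fixes f :: "real^3"
  assumes cross3_nonzero: "cross3 e f \<noteq> 0"
    and generic: "inj_on (\<lambda>z. z \<bullet> f) ((\<lambda>v. v /\<^sub>R (v \<bullet> e)) ` directions)"
begin

definition coordinates :: "real^3 \<Rightarrow> real \<times> real"
  where "coordinates z = (z \<bullet> f, z \<bullet> cross3 e f)"

definition projection :: "real^3 \<Rightarrow> real \<times> real"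
  where "projection v = coordinates v /\<^sub>R (v \<bullet> e)"

abbreviation out_hull :: "real^3 \<Rightarrow> (real \<times> real) set"
  where "out_hull x \<equiv> convex hull (projection ` out_directions x)"

abbreviation in_hull :: "real^3 \<Rightarrow> (real \<times> real) set"
  where "in_hull y \<equiv> convex hull (projection ` in_directions y)"

definition vertex_sides :: "(real^3 + real^3) set"
  where "vertex_sides = Inl ` fst ` diameters \<union> Inr ` snd ` diameters"

definition side_points :: "real^3 + real^3 \<Rightarrow> (real \<times> real) set" where
  "side_points = case_sum (\<lambda>x. projection ` out_directions x) (\<lambda>y. projection ` in_directions y)"

lemma linear_coordinates: "linear coordinates"
  by (intro linearI) (auto simp: coordinates_def inner_add_left)

lemma coordinates_inj: "coordinates z = coordinates z' \<Longrightarrow> z \<bullet> e = z' \<bullet> e \<Longrightarrow> z = z'"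
  using eq_0_if_orthogonal_cross3[of "z - z'" e f] cross3_nonzero
  by (simp add: coordinates_def inner_diff_left)

lemma inj_on_fst_projection: "inj_on fst (projection ` directions)"
proof (rule inj_onI)
  fix P Q assume same_abscissa: "P \<in> projection ` directions" "Q \<in> projection ` directions"
    "fst P = fst Q"
  have projection: "projection v = coordinates (v /\<^sub>R (v \<bullet> e))" for v
    by (simp add: projection_def linear_scale[OF linear_coordinates])
  obtain v w where P_eq: "v \<in> directions" "P = projection v"
    and Q_eq: "w \<in> directions" "Q = projection w"
    using same_abscissa by auto
  then have "v /\<^sub>R (v \<bullet> e) = w /\<^sub>R (w \<bullet> e)"
    using same_abscissa(3) by (intro inj_onD[OF generic]) (auto simp: projection coordinates_def)
  then show "P = Q"
    using P_eq Q_eq by (simp add: projection)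
qed

lemma common_projection_hullE:
  assumes "S \<subseteq> directions" "T \<subseteq> directions"
    and "q \<in> convex hull (projection ` S)" "q \<in> convex hull (projection ` T)"
  obtains z where "z \<in> convex_cone hull S" "z \<in> convex_cone hull T" "z \<bullet> e = 1" "coordinates z = q"
proof -
  have lift: "\<exists>z. z \<in> convex_cone hull S \<and> z \<bullet> e = 1 \<and> coordinates z = q"
    if "S \<subseteq> directions" "q \<in> convex hull (projection ` S)" for S
    using convex_hull_central_projectionE[OF linear_coordinates, of S e q] inner_direction_pos that
    unfolding projection_def by blast
  obtain z z' where z_lift: "z \<in> convex_cone hull S" "z \<bullet> e = 1" "coordinates z = q"
    and z'_lift: "z' \<in> convex_cone hull T" "z' \<bullet> e = 1" "coordinates z' = q"
    using lift assms by meson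
  then have "z = z'"
    using coordinates_inj by simp
  then show ?thesis
    using that z_lift z'_lift by blast
qed

lemma out_hulls_disjoint:
  assumes "x \<noteq> x'"
  shows "out_hull x \<inter> out_hull x' = {}"
proof safe
  fix q assume "q \<in> out_hull x" "q \<in> out_hull x'"
  then obtain z where "z \<in> convex_cone hull out_directions x" "z \<in> convex_cone hull out_directions x'"
    "z \<bullet> e = 1"
    using common_projection_hullE out_directions_subset by metis
  then show "q \<in> {}"
    using out_cones_disjoint[OF assms] by fastforce
qed

lemma in_hulls_disjoint:
  assumes "y \<noteq> y'"
  shows "in_hull y \<inter> in_hull y' = {}"
proof safe
  fix q assume "q \<in> in_hull y" "q \<in> in_hull y'"
  then obtain z where "z \<in> convex_cone hull in_directions y" "z \<in> convex_cone hull in_directions y'"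
    "z \<bullet> e = 1"
    using common_projection_hullE in_directions_subset by metis
  then show "q \<in> {}"
    using in_cones_disjoint[OF assms] by fastforce
qed

lemma out_in_hulls_contact:
  assumes subsets: "S \<subseteq> out_directions x" "T \<subseteq> in_directions y"
    and in_hulls: "q \<in> convex hull (projection ` S)" "q \<in> convex hull (projection ` T)"
  shows "(x, y) \<in> diameters" "q = projection (y - x)" "y - x \<in> S \<or> y - x \<in> T"
proof -
  obtain z where common: "z \<in> convex_cone hull S" "z \<in> convex_cone hull T" "z \<bullet> e = 1"
    "coordinates z = q"
    using common_projection_hullE[OF _ _ in_hulls] subsets out_directions_subset in_directions_subset
    by blast
  then have "z \<noteq> 0"
    by auto
  note contact = out_in_cones_contact[OF subsets common(1,2) this]
  show "(x, y) \<in> diameters" "y - x \<in> S \<or> y - x \<in> T"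
    using contact(1,3) common(3) by auto
  have z_eq: "z = norm z *\<^sub>R (y - x)"
    using contact(2) common(3) by simp
  then have "norm z * ((y - x) \<bullet> e) = 1"
    using common(3) by (metis inner_scaleR_left)
  then have "norm z = inverse ((y - x) \<bullet> e)"
    by (metis inverse_unique mult.commute)
  then show "q = projection (y - x)"
    using z_eq common(4) linear_scale[OF linear_coordinates] unfolding projection_def by metis
qed

lemma out_in_hulls_disjoint_or_touching: "disjoint_or_touching (out_hull x) (in_hull y)"
proof (cases "out_hull x \<inter> in_hull y = {}")
  case False
  define d P where "d = y - x" and "P = projection d"
  have meet: "out_hull x \<inter> in_hull y = {P}" and diameter: "(x, y) \<in> diameters"
    using False out_in_hulls_contact[OF order_refl order_refl, of _ x y] by (auto simp: P_def d_def)
  have directions_insert: "out_directions x = insert d (out_directions x - {d})"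
    "in_directions y = insert d (in_directions y - {d})"
    using diameter by (auto simp: d_def out_directions_def in_directions_def)
  have finite: "finite (projection ` (out_directions x - {d}))"
    "finite (projection ` (in_directions y - {d}))"
    using finite_directions out_directions_subset in_directions_subset
    by (meson finite_Diff finite_imageI finite_subset)+
  have "P \<notin> convex hull (projection ` (out_directions x - {d})) \<or>
      P \<notin> convex hull (projection ` (in_directions y - {d}))"
    using out_in_hulls_contact(3)[of "out_directions x - {d}" x "in_directions y - {d}" y P]
    by (auto simp: d_def)
  then have "P extreme_point_of out_hull x \<or> P extreme_point_of in_hull y"
    using extreme_point_of_convex_hull_insert[OF finite(1)]
      extreme_point_of_convex_hull_insert[OF finite(2)] directions_insert
    unfolding P_def by (metis image_insert)
  then show ?thesis
    using meet by (auto simp: disjoint_or_touching_def)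
qed (simp add: disjoint_or_touching_def)

lemma side_hulls_disjoint_or_touching:
  assumes "i \<noteq> j"
  shows "disjoint_or_touching (convex hull side_points i) (convex hull side_points j)"
proof (cases i; cases j)
  fix x x' assume "i = Inl x" "j = Inl x'"
  then show ?thesis
    using assms out_hulls_disjoint[of x x'] by (simp add: side_points_def disjoint_or_touching_def)
next
  fix y y' assume "i = Inr y" "j = Inr y'"
  then show ?thesis
    using assms in_hulls_disjoint[of y y'] by (simp add: side_points_def disjoint_or_touching_def)
next
  fix x y assume "i = Inl x" "j = Inr y"
  then show ?thesis
    using out_in_hulls_disjoint_or_touching by (simp add: side_points_def)
next
  fix x y assume "i = Inr y" "j = Inl x"
  then show ?thesis
    using out_in_hulls_disjoint_or_touching[of x y]
    by (simp add: side_points_def disjoint_or_touching_commute)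
qed

lemma card_sides_containing_le: "card {i\<in>vertex_sides. P \<in> convex hull side_points i} \<le> 2"
  (is "card ?A \<le> 2")
proof -
  have "P \<in> out_hull x" if "Inl x \<in> ?A" for x
    using that by (simp add: side_points_def)
  then obtain x where x_unique: "\<And>x'. Inl x' \<in> ?A \<Longrightarrow> x' = x"
    using out_hulls_disjoint by blast
  have "P \<in> in_hull y" if "Inr y \<in> ?A" for y
    using that by (simp add: side_points_def)
  then obtain y where y_unique: "\<And>y'. Inr y' \<in> ?A \<Longrightarrow> y' = y"
    using in_hulls_disjoint by blast
  have "i \<in> {Inl x, Inr y}" if "i \<in> ?A" for i
    using x_unique y_unique that by (cases i) auto
  then have "card ?A \<le> card {Inl x, Inr y}"
    by (intro card_mono) auto
  then show ?thesis
    by simp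
qed

sublocale touching_hulls vertex_sides side_points
proof
  show "finite vertex_sides"
    using finite_diameters by (simp add: vertex_sides_def)
next
  fix i assume "i \<in> vertex_sides"
  have "finite (out_directions x)" "finite (in_directions x)" for x
    using finite_directions out_directions_subset in_directions_subset by (meson finite_subset)+
  then show "finite (side_points i)"
    by (simp add: side_points_def split: sum.split)
  show "side_points i \<noteq> {}"
    using \<open>i \<in> vertex_sides\<close>
    by (force simp: vertex_sides_def side_points_def out_directions_def in_directions_def)
next
  have "side_points i \<subseteq> projection ` directions" for i
    using out_directions_subset in_directions_subset
    by (fastforce simp: side_points_def split: sum.splits)
  then show "inj_on fst (\<Union>i\<in>vertex_sides. side_points i)"
    by (intro inj_on_subset[OF inj_on_fst_projection]) blast
qed (intro side_hulls_disjoint_or_touching card_sides_containing_le; assumption)+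

theorem card_diameters_le: "card diameters \<le> 128 * card V"
proof -
  have "card diameters \<le> card contacts"
  proof (rule card_inj_on_le[where f = "\<lambda>(x, y). (Inl x, Inr y)"])
    show "(\<lambda>(x, y). (Inl x, Inr y)) ` diameters \<subseteq> contacts"
    proof safe
      fix x y assume diameter: "(x, y) \<in> diameters"
      then have "Inl x \<in> vertex_sides" "Inr y \<in> vertex_sides"
        by (force simp: vertex_sides_def)+
      moreover have "projection (y - x) \<in> side_points (Inl x) \<inter> side_points (Inr y)"
        using diameter by (auto simp: side_points_def out_directions_def in_directions_def)
      ultimately show "(Inl x, Inr y) \<in> contacts"
        by (auto simp: contacts_def)
    qed
  qed (auto simp: inj_on_def finite_contacts)
  also have "\<dots> \<le> 64 * card vertex_sides"
    by (rule card_contacts_le)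
  also have "vertex_sides \<subseteq> V <+> V"
    by (auto simp: vertex_sides_def diameters_def)
  then have "card vertex_sides \<le> card V + card V"
    using card_mono[of "V <+> V"] finite_V by (simp add: card_Plus)
  finally show ?thesis
    by simp
qed

end

lemma card_unit_diameters_le:
  fixes V :: "(real^3) set"
  assumes "finite V" and "\<And>x y. x \<in> V \<Longrightarrow> y \<in> V \<Longrightarrow> norm (y - x) \<le> 1"
  shows "card {{x, y} |x y. x \<in> V \<and> y \<in> V \<and> norm (y - x) = 1} \<le> 128 * card V"
    (is "card ?D \<le> _")
proof -
  obtain e where inj_e: "inj_on (\<lambda>z. z \<bullet> e) V"
    using exists_inj_on_inner[OF \<open>finite V\<close>] by blast
  interpret oriented_unit_diameters V e
    using assms by unfold_locales
  have unoriented: "?D \<subseteq> (\<lambda>(x, y). {x, y}) ` diameters"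
  proof safe
    fix x y assume unit_distance: "x \<in> V" "y \<in> V" "norm (y - x) = 1"
    then have "x \<bullet> e \<noteq> y \<bullet> e"
      using inj_onD[OF inj_e, of x y] by auto
    then have "(x, y) \<in> diameters \<or> (y, x) \<in> diameters"
      using unit_distance by (auto simp: diameters_def inner_diff_left norm_minus_commute)
    then show "{x, y} \<in> (\<lambda>(x, y). {x, y}) ` diameters"
      by force
  qed
  have "card diameters \<le> 128 * card V"
  proof (cases "diameters = {}")
    case False
    then have "e \<noteq> 0"
      by (auto simp: diameters_def)
    then obtain f where "inj_on (\<lambda>z. z \<bullet> f) ((\<lambda>v. v /\<^sub>R (v \<bullet> e)) ` directions)" "cross3 e f \<noteq> 0"
      using exists_inj_on_inner_cross3_nonzero[OF finite_imageI[OF finite_directions]] by blast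
    then interpret projected_unit_diameters V e f
      by unfold_locales
    show ?thesis
      by (rule card_diameters_le)
  qed simp
  then show ?thesis
    using surj_card_le[OF finite_diameters unoriented] by linarith
qed

lemma unit_diameter_representation:
  fixes T :: "'a::euclidean_space itself"
  assumes "is_diameter_graph T W E" and "finite W"
  obtains g :: "nat \<Rightarrow> 'a" where "inj_on g W"
    and "\<And>u v. u \<in> W \<Longrightarrow> v \<in> W \<Longrightarrow> norm (g v - g u) \<le> 1"
    and "\<And>u v. u \<in> W \<Longrightarrow> v \<in> W \<Longrightarrow> u \<noteq> v \<Longrightarrow> {u, v} \<in> E \<longleftrightarrow> norm (g v - g u) = 1"
proof -
  obtain f :: "nat \<Rightarrow> 'a" where inj: "inj_on f W" and edge_iff:
    "\<And>u v. u \<in> W \<Longrightarrow> v \<in> W \<Longrightarrow> u \<noteq> v \<Longrightarrow> {u, v} \<in> E \<longleftrightarrow> dist (f u) (f v) = diameter (f ` W)"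
    using assms(1) unfolding is_diameter_graph_def by blast
  define D where "D = diameter (f ` W)"
  define g where "g u = f u /\<^sub>R D" for u
  have dist_le_D: "dist (f u) (f v) \<le> D" if "u \<in> W" "v \<in> W" for u v
    unfolding D_def using that \<open>finite W\<close> by (intro diameter_bounded_bound finite_imp_bounded) auto
  have dist_pos: "0 < dist (f u) (f v)" "0 < D" if "u \<in> W" "v \<in> W" "u \<noteq> v" for u v
  proof -
    show "0 < dist (f u) (f v)"
      using inj that by (auto dest: inj_onD)
    then show "0 < D"
      using dist_le_D[OF that(1,2)] by linarith
  qed
  have norm_g: "norm (g v - g u) = dist (f u) (f v) / \<bar>D\<bar>" for u v
    unfolding g_def
    by (simp add: scaleR_diff_right[symmetric] dist_norm norm_minus_commute divide_inverse)
  show ?thesis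
  proof
    show "inj_on g W"
    proof (rule inj_onI, rule ccontr)
      fix u v assume "u \<in> W" "v \<in> W" "g u = g v" "u \<noteq> v"
      then show False
        using norm_g[of v u] dist_pos[of u v] by simp
    qed
    show "norm (g v - g u) \<le> 1" if "u \<in> W" "v \<in> W" for u v
      using dist_le_D[OF that] dist_pos[OF that] by (cases "u = v") (auto simp: norm_g)
    show "{u, v} \<in> E \<longleftrightarrow> norm (g v - g u) = 1" if "u \<in> W" "v \<in> W" "u \<noteq> v" for u v
      using edge_iff[OF that] dist_pos[OF that] by (auto simp: norm_g D_def)
  qed
qed

theorem card_diameter_graph_edges_le:
  assumes "is_diameter_graph TYPE(real^3) W E" and "finite W"
  shows "card (E \<inter> [W]\<^bsup>2\<^esup>) \<le> 128 * card W"
proof -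
  obtain g :: "nat \<Rightarrow> real^3" where inj: "inj_on g W"
    and le_1: "\<And>u v. u \<in> W \<Longrightarrow> v \<in> W \<Longrightarrow> norm (g v - g u) \<le> 1"
    and edge_iff: "\<And>u v. u \<in> W \<Longrightarrow> v \<in> W \<Longrightarrow> u \<noteq> v \<Longrightarrow> {u, v} \<in> E \<longleftrightarrow> norm (g v - g u) = 1"
    using unit_diameter_representation[OF assms] by blast
  let ?D = "{{x, y} |x y. x \<in> g ` W \<and> y \<in> g ` W \<and> norm (y - x) = 1}"
  have "card (E \<inter> [W]\<^bsup>2\<^esup>) \<le> card ?D"
  proof (rule card_inj_on_le)
    show "inj_on ((`) g) (E \<inter> [W]\<^bsup>2\<^esup>)"
      by (rule inj_on_subset[OF inj_on_image_Pow[OF inj]]) (auto simp: nsets_def)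
    show "(`) g ` (E \<inter> [W]\<^bsup>2\<^esup>) \<subseteq> ?D"
      using edge_iff by (fastforce simp: nsets_2_eq)
    have "?D \<subseteq> Pow (g ` W)"
      by auto
    then show "finite ?D"
      by (rule finite_subset) (simp add: \<open>finite W\<close>)
  qed
  also have "\<dots> \<le> 128 * card (g ` W)"
    using \<open>finite W\<close> le_1 by (intro card_unit_diameters_le) auto
  also have "card (g ` W) = card W"
    by (rule card_image[OF inj])
  finally show ?thesis .
qed

section \<open>Sparse subsets of the random graph\<close>

lemma all_pairs_eq_nsets: "all_pairs n = [{0..<n}]\<^bsup>2\<^esup>"
  by (auto simp: all_pairs_def ordered_nsets_2_eq) (metis order.strict_trans)

lemma finite_all_pairs: "finite (all_pairs n)"
  by (simp add: all_pairs_eq_nsets finite_imp_finite_nsets)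

lemma card_nsets: "finite A \<Longrightarrow> card ([A]\<^bsup>k\<^esup>) = card A choose k"
  using n_subsets[of A k] by (simp add: nsets_def rev_finite_subset cong: conj_cong)

definition expectation_gnp :: "nat \<Rightarrow> real \<Rightarrow> (nat set set \<Rightarrow> real) \<Rightarrow> real" where
  "expectation_gnp n p X =
     (\<Sum>E\<in>Pow (all_pairs n). X E * (p ^ card E * (1 - p) ^ (card (all_pairs n) - card E)))"

lemma prob_gnp_eq_expectation: "prob_gnp n p Q = expectation_gnp n p (\<lambda>E. of_bool (Q E))"
  unfolding prob_gnp_def expectation_gnp_def by (intro sum.cong) auto

lemma expectation_gnp_mono:
  assumes "0 \<le> p" "p \<le> 1" and "\<And>E. X E \<le> Y E"
  shows "expectation_gnp n p X \<le> expectation_gnp n p Y"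
  unfolding expectation_gnp_def using assms by (intro sum_mono mult_right_mono) auto

lemma expectation_gnp_sum:
  "expectation_gnp n p (\<lambda>E. \<Sum>i\<in>S. X i E) = (\<Sum>i\<in>S. expectation_gnp n p (X i))"
  unfolding expectation_gnp_def sum_distrib_right by (rule sum.swap)

lemma expectation_gnp_divide: "expectation_gnp n p (\<lambda>E. X E / c) = expectation_gnp n p X / c"
  unfolding expectation_gnp_def by (simp add: sum_divide_distrib)

lemma expectation_gnp_power_card_Int:
  fixes p x :: real
  assumes "B \<subseteq> all_pairs n"
  shows "expectation_gnp n p (\<lambda>E. x ^ card (E \<inter> B)) = (1 - p + x * p) ^ card B"
proof -
  let ?A = "all_pairs n"
  have weight: "x ^ card (E \<inter> B) * (p ^ card E * (1 - p) ^ (card ?A - card E))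
      = (\<Prod>e\<in>E. if e \<in> B then x * p else p) * (\<Prod>e\<in>?A - E. 1 - p)" if "E \<in> Pow ?A" for E
  proof -
    have edge_set: "E \<subseteq> ?A" "finite E"
      using that finite_all_pairs finite_subset by auto
    have "(\<Prod>e\<in>E. if e \<in> B then x * p else p) = (\<Prod>e\<in>E. (if e \<in> B then x else 1) * p)"
      by (rule prod.cong) auto
    also have "\<dots> = (\<Prod>e\<in>E. if e \<in> B then x else 1) * p ^ card E"
      by (simp add: prod.distrib)
    also have "(\<Prod>e\<in>E. if e \<in> B then x else 1) = x ^ card (E \<inter> B)"
      using edge_set(2) by (simp add: prod.inter_restrict[symmetric])
    finally show ?thesis
      using edge_set by (simp add: card_Diff_subset)
  qed
  have "expectation_gnp n p (\<lambda>E. x ^ card (E \<inter> B))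
      = (\<Sum>E\<in>Pow ?A. (\<Prod>e\<in>E. if e \<in> B then x * p else p) * (\<Prod>e\<in>?A - E. 1 - p))"
    unfolding expectation_gnp_def by (intro sum.cong weight) auto
  also have "\<dots> = (\<Prod>e\<in>?A. (if e \<in> B then x * p else p) + (1 - p))"
    by (rule prod_add[OF finite_all_pairs, symmetric])
  also have "\<dots> = (\<Prod>e\<in>?A. if e \<in> B then 1 - p + x * p else 1)"
    by (rule prod.cong) auto
  also have "\<dots> = (1 - p + x * p) ^ card B"
    using assms finite_all_pairs by (simp add: prod.inter_restrict[symmetric] Int_absorb1)
  finally show ?thesis .
qed

lemma prob_gnp_card_Int_le:
  assumes prob: "0 \<le> p" "p \<le> 1" and weight: "0 < x" "x \<le> 1" and pairs: "B \<subseteq> all_pairs n"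
  shows "prob_gnp n p (\<lambda>E. card (E \<inter> B) \<le> m) \<le> (1 - p + x * p) ^ card B / x ^ m"
proof -
  have "of_bool (card (E \<inter> B) \<le> m) \<le> x ^ card (E \<inter> B) / x ^ m" for E
    using weight by (simp add: power_decreasing)
  then have "prob_gnp n p (\<lambda>E. card (E \<inter> B) \<le> m) \<le> expectation_gnp n p (\<lambda>E. x ^ card (E \<inter> B) / x ^ m)"
    unfolding prob_gnp_eq_expectation by (rule expectation_gnp_mono[OF prob])
  then show ?thesis
    by (simp add: expectation_gnp_divide expectation_gnp_power_card_Int[OF pairs])
qed

lemma prob_gnp_mono:
  assumes "0 \<le> p" "p \<le> 1" and "\<And>E. Q E \<Longrightarrow> R E"
  shows "prob_gnp n p Q \<le> prob_gnp n p R"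
  unfolding prob_gnp_eq_expectation using assms by (intro expectation_gnp_mono) auto

lemma prob_gnp_Bex_le:
  assumes prob: "0 \<le> p" "p \<le> 1" and "finite S"
  shows "prob_gnp n p (\<lambda>E. \<exists>i\<in>S. Q i E) \<le> (\<Sum>i\<in>S. prob_gnp n p (Q i))"
proof -
  have "of_bool (\<exists>i\<in>S. Q i E) \<le> (\<Sum>i\<in>S. of_bool (Q i E) :: real)" for E
  proof (cases "\<exists>i\<in>S. Q i E")
    case True
    then obtain i where witness: "i \<in> S" "Q i E" by blast
    then have "(of_bool (Q i E) :: real) \<le> (\<Sum>i\<in>S. of_bool (Q i E))"
      using \<open>finite S\<close> by (intro member_le_sum) auto
    then show ?thesis
      using witness by auto
  qed (simp add: sum_nonneg)
  then show ?thesis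
    unfolding prob_gnp_eq_expectation expectation_gnp_sum[symmetric]
    by (rule expectation_gnp_mono[OF prob])
qed

definition has_sparse_subset :: "nat \<Rightarrow> nat \<Rightarrow> nat \<Rightarrow> nat set set \<Rightarrow> bool" where
  "has_sparse_subset n k m E \<longleftrightarrow> (\<exists>W\<in>[{0..<n}]\<^bsup>k\<^esup>. card (E \<inter> [W]\<^bsup>2\<^esup>) \<le> m)"

lemma prob_has_sparse_subset_le:
  assumes prob: "0 \<le> p" "p \<le> 1" and weight: "0 < x" "x \<le> 1"
  shows "prob_gnp n p (has_sparse_subset n k m)
    \<le> real (n choose k) * (1 - p + x * p) ^ (k choose 2) / x ^ m"
proof -
  let ?S = "[{0..<n}]\<^bsup>k\<^esup>"
  have "prob_gnp n p (has_sparse_subset n k m)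
      \<le> (\<Sum>W\<in>?S. prob_gnp n p (\<lambda>E. card (E \<inter> [W]\<^bsup>2\<^esup>) \<le> m))"
    unfolding has_sparse_subset_def by (intro prob_gnp_Bex_le prob finite_imp_finite_nsets) simp
  also have "\<dots> \<le> (\<Sum>W\<in>?S. (1 - p + x * p) ^ (k choose 2) / x ^ m)"
  proof (rule sum_mono)
    fix W assume "W \<in> ?S"
    then have vertices: "finite W" "card W = k" "[W]\<^bsup>2\<^esup> \<subseteq> all_pairs n"
      using nsets_mono[of W "{0..<n}" 2] by (auto simp: nsets_def all_pairs_eq_nsets)
    then show "prob_gnp n p (\<lambda>E. card (E \<inter> [W]\<^bsup>2\<^esup>) \<le> m) \<le> (1 - p + x * p) ^ (k choose 2) / x ^ m"
      using prob_gnp_card_Int_le[OF prob weight vertices(3), of m] by (simp add: card_nsets)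
  qed
  also have "\<dots> = real (n choose k) * (1 - p + x * p) ^ (k choose 2) / x ^ m"
    by (simp add: card_nsets)
  finally show ?thesis .
qed

lemma power_div_fact_le_exp:
  fixes x :: real
  assumes "0 \<le> x"
  shows "x ^ k / fact k \<le> exp x"
proof -
  have "(\<Sum>n\<in>{k}. x ^ n /\<^sub>R fact n) \<le> (\<Sum>n. x ^ n /\<^sub>R fact n)"
    by (rule sum_le_suminf) (use assms exp_converges[of x] in \<open>auto simp: sums_iff\<close>)
  then show ?thesis
    using exp_converges[of x] by (simp add: sums_iff divide_inverse mult.commute)
qed

lemma binomial_le_exp:
  assumes "0 < k" "0 < n"
  shows "real (n choose k) \<le> exp (real k * (ln (real n) + 1 - ln (real k)))"
proof -
  have "real (n choose k) * fact k \<le> real n ^ k"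
    using binomial_fact_pow[of n k] by (metis of_nat_fact of_nat_le_iff of_nat_mult of_nat_power)
  then have "real (n choose k) \<le> real n ^ k / fact k"
    by (simp add: field_simps)
  also have "\<dots> = (real k ^ k / fact k) * (real n ^ k / real k ^ k)"
    using assms by simp
  also have "\<dots> \<le> exp (real k) * (real n ^ k / real k ^ k)"
    by (intro mult_right_mono power_div_fact_le_exp) auto
  also have "\<dots> = exp (real k * (ln (real n) + 1 - ln (real k)))"
    using assms by (simp add: algebra_simps exp_add exp_diff exp_of_nat_mult)
  finally show ?thesis .
qed

lemma power_choose_two_le_exp:
  fixes q :: real
  assumes "0 < q" "0 < k"
  shows "(q * (1 + 1 / real k)) ^ (k choose 2) \<le> exp (real k * ((real k - 1) / 2 * ln q + 1 / 2))"
proof -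
  have choose: "real (k choose 2) = real k * (real k - 1) / 2"
    using \<open>0 < k\<close> by (cases k) (auto simp: choose_two real_of_nat_div algebra_simps)
  have "q * (1 + 1 / real k) \<le> q * exp (1 / real k)"
    using \<open>0 < q\<close> by (intro mult_left_mono) (auto simp: exp_ge_add_one_self)
  also have "\<dots> = exp (ln q + 1 / real k)"
    using \<open>0 < q\<close> by (simp add: exp_add)
  finally have "(q * (1 + 1 / real k)) ^ (k choose 2) \<le> exp (ln q + 1 / real k) ^ (k choose 2)"
    using \<open>0 < q\<close> by (intro power_mono) auto
  also have "\<dots> = exp (real (k choose 2) * (ln q + 1 / real k))"
    by (rule exp_of_nat_mult[symmetric])
  also have
    "real (k choose 2) * (ln q + 1 / real k) = real k * ((real k - 1) / 2 * ln q) + (real k - 1) / 2"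
    unfolding choose using \<open>0 < k\<close> by (simp add: field_simps)
  also have "\<dots> \<le> real k * ((real k - 1) / 2 * ln q + 1 / 2)"
    by (simp add: algebra_simps)
  finally show ?thesis by simp
qed

lemma inverse_power_divide_eq_exp:
  fixes q y :: real
  assumes "0 < q" "0 < y"
  shows "1 / (q / y) ^ m = exp (real m * (ln y - ln q))"
proof -
  have "1 / (q / y) ^ m = (y / q) ^ m"
    by (simp add: power_divide)
  also have "\<dots> = exp (ln (y / q)) ^ m"
    using assms by simp
  also have "\<dots> = exp (real m * (ln y - ln q))"
    using assms by (simp add: exp_of_nat_mult ln_div)
  finally show ?thesis .
qed

text \<open>The weight \<open>x = (1 - p) / (p * k)\<close> makes \<open>1 - p + x * p\<close> exceed \<open>1 - p\<close> only by the factor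
  \<open>1 + 1 / k\<close>, which costs \<open>exp (k / 2)\<close> over the \<open>k choose 2\<close> pairs.\<close>

lemma prob_has_sparse_subset_le_exp:
  fixes p :: real
  assumes prob: "0 < p" "p < 1" and k_pos: "0 < k" and n_pos: "0 < n" and q_le_pk: "1 - p \<le> p * real k"
  shows "prob_gnp n p (has_sparse_subset n k (c * k))
    \<le> exp (real k * (ln (real n * p) + real c * ln (p * real k) + 3 / 2
        + ln (1 - p) * real k / 2 - (real c + 2) * ln (1 - p)))"
proof -
  define q x where "q = 1 - p" and "x = q / (p * real k)"
  have q_bounds: "0 < q" "ln q \<le> 0" and weight: "0 < x" "x \<le> 1" and pk_pos: "0 < p * real k"
    using prob k_pos q_le_pk by (auto simp: q_def x_def divide_le_eq)
  have "1 - p + x * p = q * (1 + 1 / real k)"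
    unfolding x_def q_def[symmetric] using prob k_pos by (simp add: field_simps)
  then have "prob_gnp n p (has_sparse_subset n k (c * k))
      \<le> real (n choose k) * (q * (1 + 1 / real k)) ^ (k choose 2) * (1 / x ^ (c * k))"
    using prob_has_sparse_subset_le[of p x n k "c * k"] prob weight by simp
  also have "\<dots> \<le> exp (real k * (ln (real n) + 1 - ln (real k)))
      * exp (real k * ((real k - 1) / 2 * ln q + 1 / 2))
      * exp (real (c * k) * (ln (p * real k) - ln q))"
    unfolding x_def inverse_power_divide_eq_exp[OF q_bounds(1) pk_pos]
    using q_bounds
    by (intro mult_mono binomial_le_exp power_choose_two_le_exp k_pos n_pos order_refl) auto
  also have "\<dots> = exp (real k * ((ln (real n) + 1 - ln (real k)) + ((real k - 1) / 2 * ln q + 1 / 2)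
      + real c * (ln (p * real k) - ln q)))"
    by (simp add: exp_add[symmetric] algebra_simps)
  also have "\<dots> \<le> exp (real k * (ln (real n * p) + real c * ln (p * real k) + 3 / 2
      + ln q * real k / 2 - (real c + 2) * ln q))"
  proof -
    have "ln (real n) - ln (real k) = ln (real n * p) - ln (p * real k)"
      using n_pos prob k_pos by (simp add: ln_mult)
    also have "\<dots> \<le> ln (real n * p) - ln q"
      using q_bounds q_le_pk pk_pos by (simp add: q_def)
    finally have "(ln (real n) + 1 - ln (real k)) + ((real k - 1) / 2 * ln q + 1 / 2)
        + real c * (ln (p * real k) - ln q)
      \<le> ln (real n * p) + real c * ln (p * real k) + 3 / 2 + ln q * real k / 2 - (real c + 2) * ln q"
      using q_bounds(2) by (simp add: field_simps)
    then show ?thesis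
      by (simp add: mult_left_mono)
  qed
  finally show ?thesis
    by (simp add: q_def)
qed

lemma one_minus_le_mult_if_ln_ge:
  fixes p k :: real
  assumes "0 < p" "p < 1" "0 \<le> k" "1 \<le> - ln (1 - p) * k"
  shows "1 - p \<le> p * k"
proof -
  have "- ln (1 - p) \<le> p / (1 - p)"
    using ln_le_minus_one[of "1 / (1 - p)"] assms(1,2) by (simp add: ln_div field_simps)
  then have "1 \<le> p / (1 - p) * k"
    using assms(3,4) by (meson mult_right_mono order_trans)
  then show ?thesis
    using assms(2) by (simp add: field_simps)
qed

lemma inverse_one_minus_le_ln:
  fixes p N :: real
  assumes "0 < p" "p < 1" "1 \<le> N * p" "1 \<le> (1 - p) * ln N"
  shows "1 / (1 - p) \<le> 2 + ln (N * p)"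
proof (cases "p \<ge> 1 / 2")
  case True
  have "0 < N"
    using assms(1,3) by (metis less_le_trans zero_less_mult_pos2 zero_less_one)
  have "1 / (1 - p) \<le> ln N"
    using assms(2,4) by (simp add: field_simps)
  also have "\<dots> \<le> ln (2 * (N * p))"
    using True \<open>0 < N\<close> by simp
  also have "\<dots> = ln 2 + ln (N * p)"
    using assms(3) by (subst ln_mult) auto
  also have "\<dots> \<le> 2 + ln (N * p)"
    using ln_le_minus_one[of 2] by simp
  finally show ?thesis .
next
  case False
  then have "1 / (1 - p) \<le> 2"
    using assms(2) by (simp add: field_simps)
  then show ?thesis
    using ln_ge_zero[OF assms(3)] by linarith
qed

lemma mult_ln_less_if_mult_log_less:
  fixes p :: real
  assumes "0 < p" "p < 1" "a * log (1 / (1 - p)) x < \<kappa>"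
  shows "a * ln x < - ln (1 - p) * \<kappa>"
proof -
  have "0 < - ln (1 - p)"
    using assms(1,2) by simp
  moreover have "a * (ln x / - ln (1 - p)) < \<kappa>"
    using assms by (simp add: log_def ln_div)
  ultimately show ?thesis
    by (simp only: pos_divide_less_eq times_divide_eq_right mult.commute[of \<kappa>])
qed

text \<open>Here \<open>y\<close> stands for \<open>k * ln (1 / (1 - p))\<close>, which bounds \<open>p * k\<close>, while \<open>1 / (1 - p) \<le> 2 + y\<close>
  and \<open>ln (n * p) \<le> y / (2 + \<epsilon>)\<close>.\<close>

definition exponent_threshold :: "real \<Rightarrow> real \<Rightarrow> real \<Rightarrow> bool" where
  "exponent_threshold c \<epsilon> Y \<longleftrightarrow>
     (\<forall>y\<ge>Y. c * ln y + (c + 2) * ln (2 + y) + 5 / 2 \<le> (1 / 2 - 1 / (2 + \<epsilon>)) * y)"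

lemma exists_exponent_threshold:
  assumes "0 < \<epsilon>"
  shows "\<exists>Y. exponent_threshold c \<epsilon> Y"
proof -
  define \<gamma> where "\<gamma> = 1 / 2 - 1 / (2 + \<epsilon>)"
  have "0 < \<gamma>"
    using assms by (simp add: \<gamma>_def field_simps)
  then have "\<forall>\<^sub>F y in at_top. c * ln y + (c + 2) * ln (2 + y) + 5 / 2 \<le> \<gamma> * y"
    by real_asymp
  then show ?thesis
    by (simp add: exponent_threshold_def \<gamma>_def eventually_at_top_linorder)
qed

lemma sparse_exponent_le_minus_one:
  fixes c p \<epsilon> Y N \<kappa> :: real
  assumes prob: "0 < p" "p < 1" and "0 < \<epsilon>" "0 \<le> c" "0 < \<kappa>"
    and q_ln_ge: "1 \<le> (1 - p) * ln N" and np_ge: "1 \<le> N * p" "max Y 1 \<le> ln (N * p)"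
    and kappa_large: "(2 + \<epsilon>) * ln (N * p) < - ln (1 - p) * \<kappa>"
    and threshold: "exponent_threshold c \<epsilon> Y"
  shows "1 - p \<le> p * \<kappa>"
    and "ln (N * p) + c * ln (p * \<kappa>) + 3 / 2 + ln (1 - p) * \<kappa> / 2 - (c + 2) * ln (1 - p) \<le> - 1"
proof -
  define y where "y = - ln (1 - p) * \<kappa>"
  have "1 * ln (N * p) \<le> (2 + \<epsilon>) * ln (N * p)"
    using np_ge(2) \<open>0 < \<epsilon>\<close> by (intro mult_right_mono) auto
  then have y_ge: "1 \<le> y" "Y \<le> y" "ln (N * p) \<le> y"
    using np_ge(2) kappa_large unfolding y_def by linarith+
  then show "1 - p \<le> p * \<kappa>"
    using prob \<open>0 < \<kappa>\<close> by (intro one_minus_le_mult_if_ln_ge) (auto simp: y_def)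
  have "p * \<kappa> \<le> y"
    using ln_le_minus_one[of "1 - p"] prob \<open>0 < \<kappa>\<close> unfolding y_def by (intro mult_right_mono) auto
  then have "c * ln (p * \<kappa>) \<le> c * ln y"
    using prob \<open>0 < \<kappa>\<close> \<open>0 \<le> c\<close> by (intro mult_left_mono ln_mono) auto
  moreover have "1 / (1 - p) \<le> 2 + y"
    using inverse_one_minus_le_ln[OF prob np_ge(1) q_ln_ge] y_ge(3) by linarith
  then have "ln (1 / (1 - p)) \<le> ln (2 + y)"
    using prob by (intro ln_mono) auto
  then have "(c + 2) * - ln (1 - p) \<le> (c + 2) * ln (2 + y)"
    using prob \<open>0 \<le> c\<close> by (intro mult_left_mono) (auto simp: ln_div)
  moreover have "ln (N * p) \<le> y / (2 + \<epsilon>)"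
    using kappa_large[folded y_def] \<open>0 < \<epsilon>\<close> by (simp add: pos_le_divide_eq mult.commute)
  moreover have "c * ln y + (c + 2) * ln (2 + y) + 5 / 2 \<le> y / 2 - y / (2 + \<epsilon>)"
    using threshold y_ge(2) by (simp add: exponent_threshold_def left_diff_distrib)
  ultimately show
    "ln (N * p) + c * ln (p * \<kappa>) + 3 / 2 + ln (1 - p) * \<kappa> / 2 - (c + 2) * ln (1 - p) \<le> - 1"
    by (simp add: y_def)
qed

lemma prob_has_sparse_subset_le_half:
  fixes p \<epsilon> Y :: real
  assumes prob: "0 < p" "p < 1" and "0 < \<epsilon>" and q_ln_ge: "1 \<le> (1 - p) * ln (real n)"
    and np_ge: "1 \<le> real n * p" "max Y 1 \<le> ln (real n * p)"
    and k_large: "(2 + \<epsilon>) * log (1 / (1 - p)) (real n * p) < real k"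
    and threshold: "exponent_threshold c \<epsilon> Y"
  shows "prob_gnp n p (has_sparse_subset n k (c * k)) \<le> 1 / 2"
proof -
  have "0 < n"
    using np_ge(1) by (intro Nat.gr0I) auto
  have "0 \<le> (2 + \<epsilon>) * log (1 / (1 - p)) (real n * p)"
    using prob np_ge(1) \<open>0 < \<epsilon>\<close> by (intro mult_nonneg_nonneg) auto
  then have "0 < k"
    using k_large by (intro Nat.gr0I) auto
  note exponent = sparse_exponent_le_minus_one[OF prob \<open>0 < \<epsilon>\<close> of_nat_0_le_iff _ q_ln_ge np_ge
      mult_ln_less_if_mult_log_less[OF prob k_large] threshold]
  have "prob_gnp n p (has_sparse_subset n k (c * k)) \<le> exp (real k * (ln (real n * p)
      + real c * ln (p * real k) + 3 / 2 + ln (1 - p) * real k / 2 - (real c + 2) * ln (1 - p)))"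
    using exponent(1) \<open>0 < k\<close> \<open>0 < n\<close> by (intro prob_has_sparse_subset_le_exp prob) auto
  also have "\<dots> \<le> exp (real k * - 1)"
    unfolding exp_le_cancel_iff using exponent(2) \<open>0 < k\<close> by (intro mult_left_mono) auto
  also have "\<dots> \<le> exp (- 1)"
    using \<open>0 < k\<close> by simp
  also have "\<dots> \<le> 1 / 2"
    using exp_ge_add_one_self[of 1] by (simp add: exp_minus field_simps)
  finally show ?thesis .
qed

lemma u_gen_le:
  assumes le_half: "\<And>k. B < real k \<Longrightarrow> prob_gnp n p (good_set T conn n k) \<le> 1 / 2" and "0 \<le> B"
  shows "real (u_gen T conn n p) \<le> B"
proof (cases "\<exists>k. 0 < k \<and> prob_gnp n p (good_set T conn n k) > 1 / 2")
  case True
  let ?P = "\<lambda>k. 0 < k \<and> prob_gnp n p (good_set T conn n k) > 1 / 2"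
  have "k \<le> n" if "?P k" for k
  proof (rule ccontr)
    assume "\<not> k \<le> n"
    then have "\<not> good_set T conn n k E" for E
      using card_mono[of "{0..<n}"] by (fastforce simp: good_set_def)
    then have "prob_gnp n p (good_set T conn n k) = 0"
      by (simp add: prob_gnp_def)
    then show False
      using that by simp
  qed
  then have "?P (GREATEST k. ?P k)"
    using GreatestI_ex_nat[of ?P n] True by blast
  then have "?P (u_gen T conn n p)"
    using True by (simp add: u_gen_def)
  then show ?thesis
    using le_half[of "u_gen T conn n p"] by force
next
  case False
  then show ?thesis
    unfolding u_gen_def using \<open>0 \<le> B\<close> by (simp only: if_False of_nat_0)
qed

lemma good_set_imp_has_sparse_subset:
  assumes edges: "\<And>W E. is_diameter_graph T W E \<Longrightarrow> finite W \<Longrightarrow> card (E \<inter> [W]\<^bsup>2\<^esup>) \<le> c * card W"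
    and "good_set T conn n k E"
  shows "has_sparse_subset n k (c * k) E"
proof -
  obtain W where vertices: "W \<subseteq> {0..<n}" "card W = k" "is_diameter_graph T W E"
    using assms(2) unfolding good_set_def by blast
  moreover from vertices(1) have "finite W"
    by (rule finite_subset) simp
  ultimately show ?thesis
    using edges[of W E] by (auto simp: has_sparse_subset_def nsets_def)
qed

lemma u_gen_le_mult_log:
  fixes T :: "'a::euclidean_space itself" and c :: nat
  assumes edges: "\<And>W E. is_diameter_graph T W E \<Longrightarrow> finite W \<Longrightarrow> card (E \<inter> [W]\<^bsup>2\<^esup>) \<le> c * card W"
    and prob: "0 < p" "p < 1" and "0 < \<epsilon>" and q_ln_ge: "1 \<le> (1 - p) * ln (real n)"
    and np_ge: "1 \<le> real n * p" "max Y 1 \<le> ln (real n * p)"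
    and threshold: "exponent_threshold c \<epsilon> Y"
  shows "real (u_gen T conn n p) \<le> (2 + \<epsilon>) * log (1 / (1 - p)) (real n * p)"
proof (rule u_gen_le)
  fix k assume k_large: "(2 + \<epsilon>) * log (1 / (1 - p)) (real n * p) < real k"
  have "prob_gnp n p (good_set T conn n k) \<le> prob_gnp n p (has_sparse_subset n k (c * k))"
    using prob edges by (intro prob_gnp_mono good_set_imp_has_sparse_subset) auto
  also have "\<dots> \<le> 1 / 2"
    by (rule prob_has_sparse_subset_le_half[OF prob \<open>0 < \<epsilon>\<close> q_ln_ge np_ge k_large threshold])
  finally show "prob_gnp n p (good_set T conn n k) \<le> 1 / 2" .
next
  show "0 \<le> (2 + \<epsilon>) * log (1 / (1 - p)) (real n * p)"
    using prob np_ge(1) \<open>0 < \<epsilon>\<close> by (intro mult_nonneg_nonneg) auto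
qed

theorem eventually_u_gen_le:
  fixes T :: "'a::euclidean_space itself" and p :: "nat \<Rightarrow> real" and c :: nat
  assumes edges: "\<And>W E. is_diameter_graph T W E \<Longrightarrow> finite W \<Longrightarrow> card (E \<inter> [W]\<^bsup>2\<^esup>) \<le> c * card W"
    and prob: "\<forall>n. 0 \<le> p n \<and> p n \<le> 1"
    and np_at_top: "filterlim (\<lambda>n. real n * p n) at_top sequentially"
    and q_ln_at_top: "filterlim (\<lambda>n. (1 - p n) * ln (real n)) at_top sequentially"
    and "0 < \<epsilon>"
  shows "\<forall>\<^sub>F n in sequentially.
    real (u_gen T conn n (p n)) \<le> (2 + \<epsilon>) * log (1 / (1 - p n)) (real n * p n)"
proof -
  obtain Y where threshold: "exponent_threshold c \<epsilon> Y"
    using exists_exponent_threshold[OF \<open>0 < \<epsilon>\<close>] by blast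
  have "filterlim (\<lambda>n. ln (real n * p n)) at_top sequentially"
    using np_at_top by (rule filterlim_compose[OF ln_at_top])
  then have "\<forall>\<^sub>F n in sequentially. 1 \<le> real n * p n \<and> max Y 1 \<le> ln (real n * p n) \<and>
      1 \<le> (1 - p n) * ln (real n)"
    using np_at_top q_ln_at_top unfolding filterlim_at_top by (intro eventually_conj) blast+
  then show ?thesis
  proof eventually_elim
    case (elim n)
    then have "p n \<noteq> 0" "p n \<noteq> 1"
      by auto
    then have "0 < p n" "p n < 1"
      using prob by (auto simp: order_less_le)
    then show ?case
      using elim \<open>0 < \<epsilon>\<close> threshold by (intro u_gen_le_mult_log[OF edges]) auto
  qed
qed

theorem theorem21:
  fixes p :: "nat \<Rightarrow> real"
  assumes "\<forall>n. 0 \<le> p n \<and> p n \<le> 1"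
    and "filterlim (\<lambda>n. real n * p n) at_top sequentially"
    and "filterlim (\<lambda>n. (1 - p n) * ln (real n)) at_top sequentially"
  shows "\<forall>\<epsilon>>0. \<exists>n0. \<forall>n\<ge>n0.
           real (u3 n (p n)) \<le> (2 + \<epsilon>) * log (1 / (1 - p n)) (real n * p n) \<and>
           real (u3' n (p n)) \<le> (2 + \<epsilon>) * log (1 / (1 - p n)) (real n * p n)"
proof (intro allI impI)
  fix \<epsilon> :: real assume "0 < \<epsilon>"
  have "\<forall>\<^sub>F n in sequentially. real (u_gen TYPE(real^3) conn n (p n))
      \<le> (2 + \<epsilon>) * log (1 / (1 - p n)) (real n * p n)" for conn
    using card_diameter_graph_edges_le assms \<open>0 < \<epsilon>\<close> by (rule eventually_u_gen_le)
  then show "\<exists>n0. \<forall>n\<ge>n0.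
      real (u3 n (p n)) \<le> (2 + \<epsilon>) * log (1 / (1 - p n)) (real n * p n) \<and>
      real (u3' n (p n)) \<le> (2 + \<epsilon>) * log (1 / (1 - p n)) (real n * p n)"
    unfolding u3_def u3'_def eventually_sequentially[symmetric] by (intro eventually_conj)
qed

end
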